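(* Let $M_R$ be a module over a ring $R$ and $S=\mathrm{End}_R(M)$. The following conditions are equivalent: (1) Perspectivity is transitive in $M$. (2) For all idempotents $e,f\in S$, if $fM\sim_p eM$ in $M$, then any complement of $fM$ is perspective to any complement of $eM$. (3) For all idempotents $e,f\in S$, if $fM\sim_p eM$ in $M$, then $(1-f)M\sim_p(1-e)M$. (4) For every idempotent $e=e^2\in S$ and every split epimorphism $\phi:M\to eM$ such that $\mathrm{Ker}(\phi)\sim_p C$ for some complement $C$ of $eM$, there exists a splitting $\psi$ of $\phi$ such that $M=\mathrm{Im}(\psi)\oplus(1-e)M$. (5) For every idempotent $e=e^2\in S$ and every split epimorphism $\phi:M\to eM$ such that $\mathrm{Ker}(\phi)\sim_p C$ for some complement $C$ of $eM$, there exists a splitting $\psi$ of $\phi$ such that $e\psi$ is an automorphism of $eM$. (6) Whenever $euse=e$ for some $e=e^2\in S$, $s\in S$ and $u\in \mathrm{U}(S)$ such that $eu$ is special clean in $S$, there exists $t\in S$ such that $eute=e$ and $ete\in \mathrm{U}(eSe)$.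
   Context: Rings are associative with unity and modules are unital; $\mathrm{U}(\cdot)$ denotes the group of units of a ring, and endomorphisms act on the left of $M$. A complement of a direct summand $A$ of $M$ is a submodule $C$ with $M=A\oplus C$. Two direct summands $A,B$ of $M$ are perspective, written $A\sim_p B$, if they have a common complement in $M$. Perspectivity is transitive in $M$ if for all direct summands $A,B,C$ of $M$, $A\sim_p B\sim_p C$ implies $A\sim_p C$. A splitting of an epimorphism $\phi:M\to eM$ is a homomorphism $\psi:eM\to M$ with $\phi\psi=\mathrm{id}_{eM}$; $\phi$ is a split epimorphism if it has a splitting. An element $a$ of a ring $S$ is special clean if $a=g+v$ for some idempotent $g\in S$ and unit $v\in S$ with $aS\cap gS=0$. *)

theory Defs
  imports "HOL-Algebra.Module" "HOL-Algebra.AbelCoset"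
begin

text \<open>
  The library locale \<open>module\<close> requires a commutative ring of scalars, so unital right modules over
  an arbitrary ring are introduced here, on the library record \<open>module\<close>.  The field
  \<open>smult\<close> holds the right action: \<open>r \<odot>\<^bsub>M\<^esub> x\<close> stands for \<open>x r\<close>, whence the order of the factors in
  \<open>smult_mult\<close>.  Submodules are those of the library locale \<open>submodule\<close>, which assumes
  nothing about the ring.
\<close>

locale right_module = R?: ring R + M?: abelian_group M
  for R (structure) and M :: "('a, 'b, 'm) module_scheme" (structure) +
  assumes smult_closed [simp, intro]:
      "\<lbrakk>r \<in> carrier R; x \<in> carrier M\<rbrakk> \<Longrightarrow> r \<odot>\<^bsub>M\<^esub> x \<in> carrier M"
    and smult_l_distr:
      "\<lbrakk>r \<in> carrier R; s \<in> carrier R; x \<in> carrier M\<rbrakk> \<Longrightarrow>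
        (r \<oplus>\<^bsub>R\<^esub> s) \<odot>\<^bsub>M\<^esub> x = r \<odot>\<^bsub>M\<^esub> x \<oplus>\<^bsub>M\<^esub> s \<odot>\<^bsub>M\<^esub> x"
    and smult_r_distr:
      "\<lbrakk>r \<in> carrier R; x \<in> carrier M; y \<in> carrier M\<rbrakk> \<Longrightarrow>
        r \<odot>\<^bsub>M\<^esub> (x \<oplus>\<^bsub>M\<^esub> y) = r \<odot>\<^bsub>M\<^esub> x \<oplus>\<^bsub>M\<^esub> r \<odot>\<^bsub>M\<^esub> y"
    and smult_mult:
      "\<lbrakk>r \<in> carrier R; s \<in> carrier R; x \<in> carrier M\<rbrakk> \<Longrightarrow>
        (r \<otimes>\<^bsub>R\<^esub> s) \<odot>\<^bsub>M\<^esub> x = s \<odot>\<^bsub>M\<^esub> (r \<odot>\<^bsub>M\<^esub> x)"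
    and smult_one [simp]: "x \<in> carrier M \<Longrightarrow> \<one>\<^bsub>R\<^esub> \<odot>\<^bsub>M\<^esub> x = x"

text \<open>Homomorphisms are \<open>undefined\<close> outside the carrier, so that they are equal as HOL functions
  exactly when they agree on the carrier.\<close>

definition module_hom ::
    "('a, 'k) ring_scheme \<Rightarrow> ('a, 'b, 'm) module_scheme \<Rightarrow> ('a, 'c, 'n) module_scheme \<Rightarrow> ('b \<Rightarrow> 'c) set"
  where "module_hom R M N =
    {h \<in> hom (add_monoid M) (add_monoid N) \<inter> extensional (carrier M).
       \<forall>r \<in> carrier R. \<forall>x \<in> carrier M. h (r \<odot>\<^bsub>M\<^esub> x) = r \<odot>\<^bsub>N\<^esub> h x}"

definition module_aut :: "('a, 'k) ring_scheme \<Rightarrow> ('a, 'b, 'm) module_scheme \<Rightarrow> ('b \<Rightarrow> 'b) set"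
  where "module_aut R M = {h \<in> module_hom R M M. bij_betw h (carrier M) (carrier M)}"

definition End_ring :: "('a, 'k) ring_scheme \<Rightarrow> ('a, 'b, 'm) module_scheme \<Rightarrow> ('b \<Rightarrow> 'b) ring"
  where "End_ring R M =
    \<lparr>carrier = module_hom R M M,
     mult = compose (carrier M),
     one = (\<lambda>x \<in> carrier M. x),
     zero = (\<lambda>x \<in> carrier M. \<zero>\<^bsub>M\<^esub>),
     add = (\<lambda>f g. \<lambda>x \<in> carrier M. f x \<oplus>\<^bsub>M\<^esub> g x)\<rparr>"

text \<open>The internal direct sum decomposition \<open>M = A \<oplus> C\<close>.\<close>

definition complement ::
    "('a, 'k) ring_scheme \<Rightarrow> ('a, 'b, 'm) module_scheme \<Rightarrow> 'b set \<Rightarrow> 'b set \<Rightarrow> bool"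
  where "complement R M A C \<longleftrightarrow>
    submodule A R M \<and> submodule C R M \<and> A <+>\<^bsub>M\<^esub> C = carrier M \<and> A \<inter> C = {\<zero>\<^bsub>M\<^esub>}"

definition direct_summand ::
    "('a, 'k) ring_scheme \<Rightarrow> ('a, 'b, 'm) module_scheme \<Rightarrow> 'b set \<Rightarrow> bool"
  where "direct_summand R M A \<longleftrightarrow> (\<exists>C. complement R M A C)"

definition perspective ::
    "('a, 'k) ring_scheme \<Rightarrow> ('a, 'b, 'm) module_scheme \<Rightarrow> 'b set \<Rightarrow> 'b set \<Rightarrow> bool"
  where "perspective R M A B \<longleftrightarrow>
    direct_summand R M A \<and> direct_summand R M B \<and>
    (\<exists>C. complement R M A C \<and> complement R M B C)"

definition perspectivity_transitive ::
    "('a, 'k) ring_scheme \<Rightarrow> ('a, 'b, 'm) module_scheme \<Rightarrow> bool"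
  where "perspectivity_transitive R M \<longleftrightarrow>
    (\<forall>A B C. direct_summand R M A \<longrightarrow> direct_summand R M B \<longrightarrow> direct_summand R M C \<longrightarrow>
       perspective R M A B \<longrightarrow> perspective R M B C \<longrightarrow> perspective R M A C)"

definition splitting ::
    "('a, 'k) ring_scheme \<Rightarrow> ('a, 'b, 'm) module_scheme \<Rightarrow> ('a, 'c, 'n) module_scheme \<Rightarrow>
      ('b \<Rightarrow> 'c) \<Rightarrow> ('c \<Rightarrow> 'b) \<Rightarrow> bool"
  where "splitting R M N \<phi> \<psi> \<longleftrightarrow> \<psi> \<in> module_hom R N M \<and> (\<forall>y \<in> carrier N. \<phi> (\<psi> y) = y)"

definition split_epi ::
    "('a, 'k) ring_scheme \<Rightarrow> ('a, 'b, 'm) module_scheme \<Rightarrow> ('a, 'c, 'n) module_scheme \<Rightarrow>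
      ('b \<Rightarrow> 'c) \<Rightarrow> bool"
  where "split_epi R M N \<phi> \<longleftrightarrow>
    \<phi> \<in> module_hom R M N \<and> \<phi> ` carrier M = carrier N \<and> (\<exists>\<psi>. splitting R M N \<phi> \<psi>)"

definition idempotents :: "('a, 'k) ring_scheme \<Rightarrow> 'a set"
  where "idempotents S = {e \<in> carrier S. e \<otimes>\<^bsub>S\<^esub> e = e}"

text \<open>The corner ring \<open>e S e\<close>, whose identity is \<open>e\<close>.\<close>

definition corner :: "('a, 'k) ring_scheme \<Rightarrow> 'a \<Rightarrow> ('a, 'k) ring_scheme"
  where "corner S e = S\<lparr>carrier := {e \<otimes>\<^bsub>S\<^esub> x \<otimes>\<^bsub>S\<^esub> e | x. x \<in> carrier S}, one := e\<rparr>"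

text \<open>The right ideal \<open>a S\<close> is the left coset \<open>a <#\<^bsub>S\<^esub> carrier S\<close>.\<close>

definition special_clean :: "('a, 'k) ring_scheme \<Rightarrow> 'a \<Rightarrow> bool"
  where "special_clean S a \<longleftrightarrow>
    a \<in> carrier S \<and>
    (\<exists>g \<in> idempotents S. \<exists>v \<in> Units S.
       a = g \<oplus>\<^bsub>S\<^esub> v \<and> (a <#\<^bsub>S\<^esub> carrier S) \<inter> (g <#\<^bsub>S\<^esub> carrier S) = {\<zero>\<^bsub>S\<^esub>})"

definition all_equivalent :: "bool list \<Rightarrow> bool"
  where "all_equivalent ps \<longleftrightarrow> (\<forall>p \<in> set ps. \<forall>q \<in> set ps. p \<longleftrightarrow> q)"

lemma (in right_module) smult_zero [simp]:
  assumes "r \<in> carrier R"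
  shows "r \<odot>\<^bsub>M\<^esub> \<zero>\<^bsub>M\<^esub> = \<zero>\<^bsub>M\<^esub>"
proof -
  have "r \<odot>\<^bsub>M\<^esub> \<zero>\<^bsub>M\<^esub> \<oplus>\<^bsub>M\<^esub> r \<odot>\<^bsub>M\<^esub> \<zero>\<^bsub>M\<^esub> = r \<odot>\<^bsub>M\<^esub> \<zero>\<^bsub>M\<^esub>"
    using smult_r_distr[of r "\<zero>\<^bsub>M\<^esub>" "\<zero>\<^bsub>M\<^esub>"] assms by simp
  then show ?thesis
    using assms by (metis M.add.r_cancel_one' M.zero_closed smult_closed)
qed

lemma (in right_module) smult_minus:
  assumes "r \<in> carrier R" "x \<in> carrier M"
  shows "r \<odot>\<^bsub>M\<^esub> (\<ominus>\<^bsub>M\<^esub> x) = \<ominus>\<^bsub>M\<^esub> (r \<odot>\<^bsub>M\<^esub> x)"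
proof -
  have "r \<odot>\<^bsub>M\<^esub> (\<ominus>\<^bsub>M\<^esub> x) \<oplus>\<^bsub>M\<^esub> r \<odot>\<^bsub>M\<^esub> x = \<zero>\<^bsub>M\<^esub>"
    using smult_r_distr[of r "\<ominus>\<^bsub>M\<^esub> x" x] assms by (simp add: M.l_neg)
  then show ?thesis
    using assms by (simp add: M.minus_equality)
qed

lemma (in right_module) ring_End_ring: "ring (End_ring R M)"
proof -
  have H: "h \<in> module_hom R M M \<longleftrightarrow> h \<in> extensional (carrier M) \<and>
      (\<forall>x \<in> carrier M. h x \<in> carrier M) \<and>
      (\<forall>x \<in> carrier M. \<forall>y \<in> carrier M. h (x \<oplus>\<^bsub>M\<^esub> y) = h x \<oplus>\<^bsub>M\<^esub> h y) \<and>
      (\<forall>r \<in> carrier R. \<forall>x \<in> carrier M. h (r \<odot>\<^bsub>M\<^esub> x) = r \<odot>\<^bsub>M\<^esub> h x)" for h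
    by (auto simp: module_hom_def hom_def)
  note ac = M.a_ac
  show ?thesis
  proof (rule ringI)
    show "abelian_group (End_ring R M)"
    proof (rule abelian_groupI)
      fix f assume f: "f \<in> carrier (End_ring R M)"
      then have "(\<lambda>x \<in> carrier M. \<ominus>\<^bsub>M\<^esub> f x) \<in> carrier (End_ring R M)"
        by (auto simp: End_ring_def H M.minus_add smult_minus)
      moreover from f have
        "(\<lambda>x \<in> carrier M. \<ominus>\<^bsub>M\<^esub> f x) \<oplus>\<^bsub>End_ring R M\<^esub> f = \<zero>\<^bsub>End_ring R M\<^esub>"
        by (auto simp: End_ring_def H M.l_neg intro!: restrict_ext)
      ultimately show "\<exists>g \<in> carrier (End_ring R M). g \<oplus>\<^bsub>End_ring R M\<^esub> f = \<zero>\<^bsub>End_ring R M\<^esub>" by blast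
    qed (auto simp: End_ring_def H ac smult_r_distr fun_eq_iff extensional_def)
    show "monoid (End_ring R M)"
      by (rule monoidI) (auto simp: End_ring_def H fun_eq_iff compose_def extensional_def)
  qed (auto simp: End_ring_def H compose_def fun_eq_iff)
qed

end

theory Submission
  imports Defs
begin

text \<open>
  Every splitting of an epimorphism \<open>\<phi> : M \<rightarrow> eM\<close> has a complement of \<open>Ker \<phi>\<close> as its image, and
  every complement of \<open>Ker \<phi>\<close> is the image of a splitting.  So both (4) and (5) say that
  \<open>Ker \<phi> \<sim>\<^sub>p C\<close> for a complement \<open>C\<close> of \<open>eM\<close> forces \<open>Ker \<phi> \<sim>\<^sub>p (1 - e)M\<close>.  This is transitivity along
  \<open>Ker \<phi> \<sim>\<^sub>p C \<sim>\<^sub>p (1 - e)M\<close>; conversely a chain \<open>A \<sim>\<^sub>p B \<sim>\<^sub>p C\<close>, with \<open>X\<close> a common complement of \<open>A, B\<close> and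
  \<open>Y\<close> one of \<open>B, C\<close>, is of this form, where \<open>eM = Y\<close>, \<open>(1 - e)M = C\<close> and \<open>\<phi>\<close> is the projection onto
  \<open>X\<close> along \<open>A\<close> followed by the projection onto \<open>Y\<close> along \<open>B\<close>.

  Condition (6) is (5) in ring language.  An endomorphism \<open>a\<close> with \<open>aM = eM\<close> is special clean iff
  \<open>Ker a \<sim>\<^sub>p C\<close> for a complement \<open>C\<close> of \<open>eM\<close>: given \<open>a = g + v\<close> take \<open>C = gM\<close>, with common complement
  \<open>(1 - g)M\<close>; given a common complement \<open>X\<close> of \<open>Ker a\<close> and \<open>C\<close>, let \<open>g\<close> be the projection onto \<open>C\<close>
  along \<open>X\<close>.  In the latter situation \<open>u = a + (1 - e)g\<close> is a unit with \<open>eu = a\<close>.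
\<close>

context right_module
begin

subsection \<open>The endomorphism ring\<close>

abbreviation "E \<equiv> End_ring R M"

sublocale End: ring E
  by (rule ring_End_ring)

lemma End_iff:
  "h \<in> carrier E \<longleftrightarrow> h \<in> extensional (carrier M) \<and> h \<in> carrier M \<rightarrow> carrier M \<and>
     (\<forall>x \<in> carrier M. \<forall>y \<in> carrier M. h (x \<oplus>\<^bsub>M\<^esub> y) = h x \<oplus>\<^bsub>M\<^esub> h y) \<and>
     (\<forall>r \<in> carrier R. \<forall>x \<in> carrier M. h (r \<odot>\<^bsub>M\<^esub> x) = r \<odot>\<^bsub>M\<^esub> h x)"
  by (auto simp: End_ring_def module_hom_def hom_def)

lemma End_closed [simp, intro]: "h \<in> carrier E \<Longrightarrow> x \<in> carrier M \<Longrightarrow> h x \<in> carrier M"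
  by (auto simp: End_iff)

lemma End_add:
  "h \<in> carrier E \<Longrightarrow> x \<in> carrier M \<Longrightarrow> y \<in> carrier M \<Longrightarrow> h (x \<oplus>\<^bsub>M\<^esub> y) = h x \<oplus>\<^bsub>M\<^esub> h y"
  by (auto simp: End_iff)

lemma End_smult:
  "h \<in> carrier E \<Longrightarrow> r \<in> carrier R \<Longrightarrow> x \<in> carrier M \<Longrightarrow> h (r \<odot>\<^bsub>M\<^esub> x) = r \<odot>\<^bsub>M\<^esub> h x"
  by (auto simp: End_iff)

lemma End_zero [simp]: "h \<in> carrier E \<Longrightarrow> h \<zero>\<^bsub>M\<^esub> = \<zero>\<^bsub>M\<^esub>"
  using End_add[of h "\<zero>\<^bsub>M\<^esub>" "\<zero>\<^bsub>M\<^esub>"] by simp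

lemma End_uminus:
  assumes "h \<in> carrier E" "x \<in> carrier M"
  shows "h (\<ominus>\<^bsub>M\<^esub> x) = \<ominus>\<^bsub>M\<^esub> h x"
proof -
  have "h (\<ominus>\<^bsub>M\<^esub> x) \<oplus>\<^bsub>M\<^esub> h x = \<zero>\<^bsub>M\<^esub>"
    using assms End_add[of h "\<ominus>\<^bsub>M\<^esub> x" x] by (simp add: M.l_neg)
  then show ?thesis
    using assms by (simp add: M.minus_equality)
qed

lemma End_minus:
  "h \<in> carrier E \<Longrightarrow> x \<in> carrier M \<Longrightarrow> y \<in> carrier M \<Longrightarrow> h (x \<ominus>\<^bsub>M\<^esub> y) = h x \<ominus>\<^bsub>M\<^esub> h y"
  by (simp add: a_minus_def End_add End_uminus)

text \<open>Members of \<open>E\<close> are \<open>undefined\<close> off the carrier, so agreement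
  on the carrier is already equality. Identities in the ring are checked pointwise through this
  rule.\<close>

lemma End_eqI:
  "g \<in> carrier E \<Longrightarrow> h \<in> carrier E \<Longrightarrow> (\<And>x. x \<in> carrier M \<Longrightarrow> g x = h x) \<Longrightarrow> g = h"
  by (auto simp: End_iff intro: extensionalityI)

lemma
  assumes "x \<in> carrier M"
  shows mult_apply [simp]: "(g \<otimes>\<^bsub>E\<^esub> h) x = g (h x)"
    and add_apply [simp]: "(g \<oplus>\<^bsub>E\<^esub> h) x = g x \<oplus>\<^bsub>M\<^esub> h x"
    and one_apply [simp]: "\<one>\<^bsub>E\<^esub> x = x"
    and zero_apply [simp]: "\<zero>\<^bsub>E\<^esub> x = \<zero>\<^bsub>M\<^esub>"
  using assms by (auto simp: End_ring_def compose_def)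

section \<open>Cancellation of differences in \<open>M\<close>\<close>

lemma minus_add_cancel: "x \<in> carrier M \<Longrightarrow> y \<in> carrier M \<Longrightarrow> (x \<ominus>\<^bsub>M\<^esub> y) \<oplus>\<^bsub>M\<^esub> y = x"
  by (simp add: a_minus_def M.a_assoc M.l_neg)

lemma add_minus_cancel: "x \<in> carrier M \<Longrightarrow> y \<in> carrier M \<Longrightarrow> x \<oplus>\<^bsub>M\<^esub> (y \<ominus>\<^bsub>M\<^esub> x) = y"
  using minus_add_cancel[of y x] M.a_comm[of x "y \<ominus>\<^bsub>M\<^esub> x"] by simp

lemma add_minus_cancel_left: "x \<in> carrier M \<Longrightarrow> y \<in> carrier M \<Longrightarrow> (x \<oplus>\<^bsub>M\<^esub> y) \<ominus>\<^bsub>M\<^esub> x = y"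
  using M.a_comm[of x y] by (simp add: a_minus_def M.a_assoc M.r_neg)

lemma add_minus_cancel_right: "x \<in> carrier M \<Longrightarrow> y \<in> carrier M \<Longrightarrow> (x \<oplus>\<^bsub>M\<^esub> y) \<ominus>\<^bsub>M\<^esub> y = x"
  by (simp add: a_minus_def M.a_assoc M.r_neg)

lemma add_minus_add_cancel:
  assumes "x \<in> carrier M" "y \<in> carrier M" "z \<in> carrier M"
  shows "(x \<oplus>\<^bsub>M\<^esub> y) \<ominus>\<^bsub>M\<^esub> (x \<oplus>\<^bsub>M\<^esub> z) = y \<ominus>\<^bsub>M\<^esub> z"
proof -
  have "(x \<oplus>\<^bsub>M\<^esub> y) \<ominus>\<^bsub>M\<^esub> (x \<oplus>\<^bsub>M\<^esub> z) = ((x \<oplus>\<^bsub>M\<^esub> y) \<ominus>\<^bsub>M\<^esub> x) \<ominus>\<^bsub>M\<^esub> z"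
    using assms by (simp add: a_minus_def M.minus_add M.a_assoc)
  then show ?thesis
    using assms by (simp add: add_minus_cancel_left)
qed

text \<open>Subtraction in \<open>E\<close> adds an inverse that comes from the group axioms, with
  no pointwise formula to unfold; adding \<open>h\<close> back and cancelling determines its
  value.\<close>

lemma minus_apply [simp]:
  assumes "g \<in> carrier E" "h \<in> carrier E" "x \<in> carrier M"
  shows "(g \<ominus>\<^bsub>E\<^esub> h) x = g x \<ominus>\<^bsub>M\<^esub> h x"
proof -
  have "(g \<ominus>\<^bsub>E\<^esub> h) x \<oplus>\<^bsub>M\<^esub> h x = ((g \<ominus>\<^bsub>E\<^esub> h) \<oplus>\<^bsub>E\<^esub> h) x"
    using assms by simp
  also have "(g \<ominus>\<^bsub>E\<^esub> h) \<oplus>\<^bsub>E\<^esub> h = g"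
    using assms by (simp add: a_minus_def End.a_assoc End.l_neg)
  finally show ?thesis
    using assms by (metis End.minus_closed End_closed M.add.right_cancel M.minus_closed minus_add_cancel)
qed

subsection \<open>Direct sum decompositions and idempotents\<close>

text \<open>Closure under negation, which the library notion of a subgroup demands, comes from the
  action of the scalar -1.\<close>

lemma submodule_iff:
  "submodule A R M \<longleftrightarrow> A \<subseteq> carrier M \<and> \<zero>\<^bsub>M\<^esub> \<in> A \<and>
     (\<forall>x \<in> A. \<forall>y \<in> A. x \<oplus>\<^bsub>M\<^esub> y \<in> A) \<and> (\<forall>r \<in> carrier R. \<forall>x \<in> A. r \<odot>\<^bsub>M\<^esub> x \<in> A)"
proof -
  have *: "\<ominus>\<^bsub>M\<^esub> x = (\<ominus>\<^bsub>R\<^esub> \<one>\<^bsub>R\<^esub>) \<odot>\<^bsub>M\<^esub> x" if "x \<in> carrier M" for x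
  proof -
    have "(\<ominus>\<^bsub>R\<^esub> \<one>\<^bsub>R\<^esub>) \<odot>\<^bsub>M\<^esub> x \<oplus>\<^bsub>M\<^esub> \<one>\<^bsub>R\<^esub> \<odot>\<^bsub>M\<^esub> x = (\<ominus>\<^bsub>R\<^esub> \<one>\<^bsub>R\<^esub> \<oplus>\<^bsub>R\<^esub> \<one>\<^bsub>R\<^esub>) \<odot>\<^bsub>M\<^esub> x"
      using that by (intro smult_l_distr[symmetric]) auto
    also have "\<dots> = \<zero>\<^bsub>R\<^esub> \<odot>\<^bsub>M\<^esub> x" by (simp add: R.l_neg)
    also have "\<dots> = \<zero>\<^bsub>M\<^esub>"
      using smult_l_distr[of "\<zero>\<^bsub>R\<^esub>" "\<zero>\<^bsub>R\<^esub>" x] that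
      by (metis M.add.r_cancel_one' R.r_zero R.zero_closed smult_closed)
    finally show ?thesis using that by (simp add: M.minus_equality)
  qed
  show ?thesis
    by (auto simp: submodule_def submodule_axioms_def subgroup_def * subset_iff simp flip: a_inv_def)
qed

lemma submodule_minus:
  assumes "submodule A R M" "x \<in> A" "y \<in> A"
  shows "x \<ominus>\<^bsub>M\<^esub> y \<in> A"
  using assms by (auto simp: submodule_def subgroup_def a_minus_def a_inv_def)

text \<open>For submodules, one inclusion in each of the two set equations of a direct sum is
  automatic; only the other two are kept.\<close>

lemma complement_iff:
  "complement R M A C \<longleftrightarrow> submodule A R M \<and> submodule C R M \<and>
     (\<forall>x \<in> carrier M. \<exists>a \<in> A. \<exists>c \<in> C. x = a \<oplus>\<^bsub>M\<^esub> c) \<and> (\<forall>x \<in> A. x \<in> C \<longrightarrow> x = \<zero>\<^bsub>M\<^esub>)"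
proof -
  have "A <+>\<^bsub>M\<^esub> C = carrier M \<longleftrightarrow>
      (\<forall>x \<in> carrier M. \<exists>a \<in> A. \<exists>c \<in> C. x = a \<oplus>\<^bsub>M\<^esub> c)"
    and "A \<inter> C = {\<zero>\<^bsub>M\<^esub>} \<longleftrightarrow> (\<forall>x \<in> A. x \<in> C \<longrightarrow> x = \<zero>\<^bsub>M\<^esub>)"
    if "submodule A R M" "submodule C R M"
  proof -
    have "A \<subseteq> carrier M" "C \<subseteq> carrier M" "\<zero>\<^bsub>M\<^esub> \<in> A" "\<zero>\<^bsub>M\<^esub> \<in> C"
      using that by (simp_all add: submodule_iff)
    then show "A <+>\<^bsub>M\<^esub> C = carrier M \<longleftrightarrow>
        (\<forall>x \<in> carrier M. \<exists>a \<in> A. \<exists>c \<in> C. x = a \<oplus>\<^bsub>M\<^esub> c)"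
      and "A \<inter> C = {\<zero>\<^bsub>M\<^esub>} \<longleftrightarrow> (\<forall>x \<in> A. x \<in> C \<longrightarrow> x = \<zero>\<^bsub>M\<^esub>)"
      unfolding set_add_def' by blast+
  qed
  then show ?thesis
    unfolding complement_def by metis
qed

lemma complement_subset:
  "complement R M A C \<Longrightarrow> A \<subseteq> carrier M" "complement R M A C \<Longrightarrow> C \<subseteq> carrier M"
  by (simp_all add: complement_iff submodule_iff)

lemma complement_decompose:
  assumes "complement R M A C" "x \<in> carrier M"
  obtains a c where "a \<in> A" "c \<in> C" "x = a \<oplus>\<^bsub>M\<^esub> c"
  using assms unfolding complement_iff by blast

lemma complement_sym:
  assumes "complement R M A C"
  shows "complement R M C A"
proof -
  note AC = complement_subset[OF assms]
  have "\<exists>c \<in> C. \<exists>a \<in> A. x = c \<oplus>\<^bsub>M\<^esub> a" if x: "x \<in> carrier M" for x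
  proof -
    obtain a c where ac: "a \<in> A" "c \<in> C" "x = a \<oplus>\<^bsub>M\<^esub> c"
      using complement_decompose[OF assms x] .
    then have "x = c \<oplus>\<^bsub>M\<^esub> a"
      using AC by (simp add: M.a_comm subset_iff)
    then show ?thesis using ac by blast
  qed
  then show ?thesis
    using assms unfolding complement_iff by blast
qed

text \<open>A common complement itself shows that both sides are direct summands.\<close>

lemma perspective_iff:
  "perspective R M A B \<longleftrightarrow> (\<exists>X. complement R M A X \<and> complement R M B X)"
  by (auto simp: perspective_def direct_summand_def)

lemma End_image_submodule:
  assumes "h \<in> carrier E" "submodule A R M"
  shows "submodule (h ` A) R M"
  unfolding submodule_iff
proof (intro conjI ballI)
  have A: "A \<subseteq> carrier M" "\<zero>\<^bsub>M\<^esub> \<in> A"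
    and closed: "\<And>x y. x \<in> A \<Longrightarrow> y \<in> A \<Longrightarrow> x \<oplus>\<^bsub>M\<^esub> y \<in> A"
      "\<And>r x. r \<in> carrier R \<Longrightarrow> x \<in> A \<Longrightarrow> r \<odot>\<^bsub>M\<^esub> x \<in> A"
    using assms(2) by (simp_all add: submodule_iff)
  show "h ` A \<subseteq> carrier M" using A assms(1) by auto
  show "\<zero>\<^bsub>M\<^esub> \<in> h ` A" using A assms(1) by (metis End_zero imageI)
  show "x \<oplus>\<^bsub>M\<^esub> y \<in> h ` A" if "x \<in> h ` A" "y \<in> h ` A" for x y
    using that A closed(1) assms(1) by (auto simp flip: End_add simp: subset_iff)
  show "r \<odot>\<^bsub>M\<^esub> x \<in> h ` A" if "r \<in> carrier R" "x \<in> h ` A" for r x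
    using that A closed(2) assms(1) by (auto simp flip: End_smult simp: subset_iff)
qed

lemma End_kernel_submodule:
  "h \<in> carrier E \<Longrightarrow> submodule {x \<in> carrier M. h x = \<zero>\<^bsub>M\<^esub>} R M"
  by (auto simp: submodule_iff End_add End_smult)

lemma submodule_carrier: "submodule (carrier M) R M"
  by (auto simp: submodule_iff)

section \<open>Idempotents as projections\<close>

lemma idempotents_apply:
  "e \<in> idempotents E \<Longrightarrow> x \<in> carrier M \<Longrightarrow> e (e x) = e x"
  using mult_apply[of x e e] by (simp add: idempotents_def)

lemma idempotents_closed: "e \<in> idempotents E \<Longrightarrow> e \<in> carrier E"
  by (simp add: idempotents_def)

lemma minus_self_eq_zero: "x \<in> carrier M \<Longrightarrow> x \<ominus>\<^bsub>M\<^esub> x = \<zero>\<^bsub>M\<^esub>"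
  by (simp add: a_minus_def M.r_neg)

lemma minus_eq_zero_iff:
  "x \<in> carrier M \<Longrightarrow> y \<in> carrier M \<Longrightarrow> x \<ominus>\<^bsub>M\<^esub> y = \<zero>\<^bsub>M\<^esub> \<longleftrightarrow> x = y"
  using minus_add_cancel[of x y] by (auto simp: minus_self_eq_zero)

lemma idempotent_image:
  assumes "e \<in> idempotents E"
  shows "e ` carrier M = {x \<in> carrier M. e x = x}"
proof -
  have "x \<in> e ` carrier M" if "x \<in> carrier M" "e x = x" for x
    using that by (metis imageI)
  then show ?thesis
    using idempotents_apply[OF assms] idempotents_closed[OF assms] by auto
qed

text \<open>\<open>e\<close> kills \<open>x - e x\<close>, and a point killed by \<open>e\<close> is
  its own image under \<open>1 - e\<close>.\<close>

lemma idempotent_image_one_minus: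
  assumes "e \<in> idempotents E"
  shows "(\<one>\<^bsub>E\<^esub> \<ominus>\<^bsub>E\<^esub> e) ` carrier M = {x \<in> carrier M. e x = \<zero>\<^bsub>M\<^esub>}"
proof -
  note e = idempotents_closed[OF assms]
  have "x \<in> (\<one>\<^bsub>E\<^esub> \<ominus>\<^bsub>E\<^esub> e) ` carrier M" if "x \<in> carrier M" "e x = \<zero>\<^bsub>M\<^esub>" for x
  proof (rule image_eqI)
    show "x = (\<one>\<^bsub>E\<^esub> \<ominus>\<^bsub>E\<^esub> e) x"
      using that e minus_add_cancel[of x "\<zero>\<^bsub>M\<^esub>"] by simp
  qed (rule that(1))
  then show ?thesis
    using e idempotents_apply[OF assms]
    by (auto simp: End_minus minus_self_eq_zero)
qed

text \<open>Every x is \<open>e x + (x - e x)\<close>, and a point that \<open>e\<close> both fixes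
  and kills is zero.\<close>

lemma idempotent_complement:
  assumes "e \<in> idempotents E"
  shows "complement R M (e ` carrier M) ((\<one>\<^bsub>E\<^esub> \<ominus>\<^bsub>E\<^esub> e) ` carrier M)"
  unfolding complement_iff
proof (intro conjI ballI impI)
  note e = idempotents_closed[OF assms]
  show "submodule (e ` carrier M) R M" "submodule ((\<one>\<^bsub>E\<^esub> \<ominus>\<^bsub>E\<^esub> e) ` carrier M) R M"
    by (intro End_image_submodule submodule_carrier End.minus_closed End.one_closed e)+
  show "\<exists>a \<in> e ` carrier M. \<exists>c \<in> (\<one>\<^bsub>E\<^esub> \<ominus>\<^bsub>E\<^esub> e) ` carrier M. x = a \<oplus>\<^bsub>M\<^esub> c"
    if "x \<in> carrier M" for x
  proof (intro bexI)
    have "(x \<ominus>\<^bsub>M\<^esub> e x) \<oplus>\<^bsub>M\<^esub> e x = e x \<oplus>\<^bsub>M\<^esub> (x \<ominus>\<^bsub>M\<^esub> e x)"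
      using that e by (intro M.a_comm) auto
    then show "x = e x \<oplus>\<^bsub>M\<^esub> (\<one>\<^bsub>E\<^esub> \<ominus>\<^bsub>E\<^esub> e) x"
      using that e minus_add_cancel[of x "e x"] by simp
  qed (use that in blast)+
  show "x = \<zero>\<^bsub>M\<^esub>" if "x \<in> e ` carrier M" "x \<in> (\<one>\<^bsub>E\<^esub> \<ominus>\<^bsub>E\<^esub> e) ` carrier M" for x
    using that unfolding idempotent_image_one_minus[OF assms] idempotent_image[OF assms] by simp
qed

text \<open>The difference \<open>a - a'\<close> equals \<open>c' - c\<close>, so it lies in both
  \<open>A\<close> and \<open>C\<close> and vanishes.\<close>

lemma complement_unique:
  assumes AC: "complement R M A C" and "a \<in> A" "a' \<in> A" "c \<in> C" "c' \<in> C"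
    and eq: "a \<oplus>\<^bsub>M\<^esub> c = a' \<oplus>\<^bsub>M\<^esub> c'"
  shows "a = a'"
proof -
  have sub: "submodule A R M" "submodule C R M"
    using AC by (auto simp: complement_iff)
  then have M: "a \<in> carrier M" "a' \<in> carrier M" "c \<in> carrier M" "c' \<in> carrier M"
    using assms by (auto simp: submodule_iff)
  have "a = (a \<oplus>\<^bsub>M\<^esub> c) \<ominus>\<^bsub>M\<^esub> c"
    using M by (simp add: a_minus_def M.a_assoc M.r_neg)
  also have "\<dots> = (c' \<ominus>\<^bsub>M\<^esub> c) \<oplus>\<^bsub>M\<^esub> a'"
    unfolding eq using M by (simp add: a_minus_def M.a_ac)
  finally have "a \<ominus>\<^bsub>M\<^esub> a' = c' \<ominus>\<^bsub>M\<^esub> c"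
    using M by (simp add: a_minus_def M.a_assoc M.r_neg)
  then have "a \<ominus>\<^bsub>M\<^esub> a' \<in> C"
    using sub assms by (simp add: submodule_minus)
  then have "a \<ominus>\<^bsub>M\<^esub> a' = \<zero>\<^bsub>M\<^esub>"
    using AC sub assms by (auto simp: complement_iff submodule_minus)
  then show ?thesis
    using M by (simp add: minus_eq_zero_iff)
qed

text \<open>The converse of \<open>idempotent_complement\<close>: the projection onto
  \<open>A\<close> along \<open>C\<close> is linear and idempotent. It turns decompositions of
  \<open>M\<close> into elements of the ring.\<close>

lemma obtain_projection:
  assumes AC: "complement R M A C"
  obtains p where "p \<in> idempotents E" "p ` carrier M = A"
    "(\<one>\<^bsub>E\<^esub> \<ominus>\<^bsub>E\<^esub> p) ` carrier M = C"
proof -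
  \<comment> \<open>The \<open>A\<close>-component of x, well defined by
    \<open>complement_unique\<close>.\<close>
  define p where "p = (\<lambda>x \<in> carrier M. THE a. a \<in> A \<and> (\<exists>c \<in> C. x = a \<oplus>\<^bsub>M\<^esub> c))"
  have sub: "submodule A R M" "submodule C R M"
    using AC by (auto simp: complement_iff)
  then have AM: "a \<in> A \<Longrightarrow> a \<in> carrier M" and CM: "c \<in> C \<Longrightarrow> c \<in> carrier M" for a c
    by (auto simp: submodule_iff)
  have p: "p (a \<oplus>\<^bsub>M\<^esub> c) = a" if "a \<in> A" "c \<in> C" for a c
    unfolding p_def using that AM CM
    by (auto intro!: the_equality intro: complement_unique[OF AC])
  have dec: "\<exists>a \<in> A. \<exists>c \<in> C. x = a \<oplus>\<^bsub>M\<^esub> c" if "x \<in> carrier M" for x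
    using complement_decompose[OF AC that] by metis
  have [simp]: "\<zero>\<^bsub>M\<^esub> \<in> A" "\<zero>\<^bsub>M\<^esub> \<in> C"
    using sub by (auto simp: submodule_iff)
  have pA: "p a = a" if "a \<in> A" for a
    using p[of a "\<zero>\<^bsub>M\<^esub>"] that AM by simp
  have pC: "p c = \<zero>\<^bsub>M\<^esub>" if "c \<in> C" for c
    using p[of "\<zero>\<^bsub>M\<^esub>" c] that CM by simp
  have pE: "p \<in> carrier E"
    unfolding End_iff
  proof (intro conjI ballI)
    show "p \<in> extensional (carrier M)" by (simp add: p_def)
    show "p \<in> carrier M \<rightarrow> carrier M"
      using dec p AM by fastforce
    show "p (x \<oplus>\<^bsub>M\<^esub> y) = p x \<oplus>\<^bsub>M\<^esub> p y" if xy: "x \<in> carrier M" "y \<in> carrier M" for x y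
    proof -
      obtain a c b d where *: "a \<in> A" "c \<in> C" "b \<in> A" "d \<in> C" "x = a \<oplus>\<^bsub>M\<^esub> c" "y = b \<oplus>\<^bsub>M\<^esub> d"
        using dec xy by meson
      then have "x \<oplus>\<^bsub>M\<^esub> y = (a \<oplus>\<^bsub>M\<^esub> b) \<oplus>\<^bsub>M\<^esub> (c \<oplus>\<^bsub>M\<^esub> d)"
        using AM CM by (simp add: M.a_ac)
      moreover have "a \<oplus>\<^bsub>M\<^esub> b \<in> A" "c \<oplus>\<^bsub>M\<^esub> d \<in> C"
        using * sub by (auto simp: submodule_iff)
      ultimately show ?thesis
        using * p by simp
    qed
    show "p (r \<odot>\<^bsub>M\<^esub> x) = r \<odot>\<^bsub>M\<^esub> p x" if r: "r \<in> carrier R" and x: "x \<in> carrier M" for r x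
    proof -
      obtain a c where *: "a \<in> A" "c \<in> C" "x = a \<oplus>\<^bsub>M\<^esub> c"
        using dec x by meson
      moreover have "r \<odot>\<^bsub>M\<^esub> a \<in> A" "r \<odot>\<^bsub>M\<^esub> c \<in> C"
        using * r sub by (auto simp: submodule_iff)
      ultimately show ?thesis
        using p r AM CM by (simp add: smult_r_distr)
    qed
  qed
  have range: "p x \<in> A" if "x \<in> carrier M" for x
    using dec[OF that] p by auto
  have idem: "p \<in> idempotents E"
    unfolding idempotents_def using pE pA range by (auto intro!: End_eqI)
  moreover have "p ` carrier M = A"
    unfolding idempotent_image[OF idem] using pA AM range by force
  moreover have "x \<in> C" if "x \<in> carrier M" "p x = \<zero>\<^bsub>M\<^esub>" for x
    using dec[OF that(1)] p that(2) CM by fastforce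
  then have "(\<one>\<^bsub>E\<^esub> \<ominus>\<^bsub>E\<^esub> p) ` carrier M = C"
    unfolding idempotent_image_one_minus[OF idem] using pC CM by auto
  ultimately show thesis by (rule that)
qed

section \<open>Units of the endomorphism ring\<close>

lemma bij_Units:
  assumes h: "h \<in> carrier E" and bij: "bij_betw h (carrier M) (carrier M)"
  shows "h \<in> Units E"
proof -
  define k where "k = (\<lambda>x \<in> carrier M. inv_into (carrier M) h x)"
  have k: "k x \<in> carrier M" "h (k x) = x" if "x \<in> carrier M" for x
    using that bij by (auto simp: k_def bij_betw_def f_inv_into_f inv_into_into)
  have kh: "k (h x) = x" if "x \<in> carrier M" for x
    using that bij h by (auto simp: k_def bij_betw_def)
  \<comment> \<open>With this rule, each linearity law for the inverse \<open>k\<close> is checked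
    by applying \<open>h\<close> to the proposed value.\<close>
  have kI: "k y = x" if "x \<in> carrier M" "h x = y" for x y
    using that kh by blast
  have "k \<in> carrier E"
    unfolding End_iff
  proof (intro conjI ballI)
    show "k \<in> extensional (carrier M)" by (simp add: k_def)
  qed (use h k in \<open>auto intro!: kI simp: End_add End_smult\<close>)
  moreover have "h \<otimes>\<^bsub>E\<^esub> k = \<one>\<^bsub>E\<^esub>" "k \<otimes>\<^bsub>E\<^esub> h = \<one>\<^bsub>E\<^esub>"
    using h k kh \<open>k \<in> carrier E\<close> by (auto intro!: End_eqI)
  ultimately show ?thesis
    using h by (auto simp: Units_def)
qed

abbreviation Ker where "Ker h \<equiv> {x \<in> carrier M. h x = \<zero>\<^bsub>M\<^esub>}"

text \<open>Differences turn a trivial kernel into injectivity. All units constructed below are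
  recognised by this criterion.\<close>

lemma trivial_kernel_surj_Units:
  assumes h: "h \<in> carrier E"
    and ker: "\<And>x. x \<in> carrier M \<Longrightarrow> h x = \<zero>\<^bsub>M\<^esub> \<Longrightarrow> x = \<zero>\<^bsub>M\<^esub>"
    and surj: "\<And>y. y \<in> carrier M \<Longrightarrow> \<exists>x \<in> carrier M. h x = y"
  shows "h \<in> Units E"
proof (rule bij_Units[OF h], rule bij_betw_imageI)
  show "inj_on h (carrier M)"
  proof (rule inj_onI)
    fix x y assume xy: "x \<in> carrier M" "y \<in> carrier M" "h x = h y"
    then have "h (x \<ominus>\<^bsub>M\<^esub> y) = \<zero>\<^bsub>M\<^esub>"
      using h by (simp add: End_minus minus_self_eq_zero)
    then show "x = y"
      using xy(1,2) ker[of "x \<ominus>\<^bsub>M\<^esub> y"] by (simp add: minus_eq_zero_iff)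
  qed
  show "h ` carrier M = carrier M"
    using h surj by fast
qed

lemma Units_inverse:
  assumes "u \<in> Units E"
  obtains w where "w \<in> carrier E" "\<And>x. x \<in> carrier M \<Longrightarrow> u (w x) = x"
    "\<And>x. x \<in> carrier M \<Longrightarrow> w (u x) = x"
proof -
  obtain w where w: "w \<in> carrier E" "w \<otimes>\<^bsub>E\<^esub> u = \<one>\<^bsub>E\<^esub>" "u \<otimes>\<^bsub>E\<^esub> w = \<one>\<^bsub>E\<^esub>"
    using assms by (auto simp: Units_def)
  have "u (w x) = x" "w (u x) = x" if "x \<in> carrier M" for x
    using that w mult_apply[of x u w] mult_apply[of x w u] one_apply[of x] by simp_all
  with w(1) show thesis by (rule that)
qed

subsection \<open>Splittings\<close>

text \<open>The record for a submodule keeps the operations of \<open>M\<close>, so maps into it can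
  be handled as elements of \<open>E\<close>.\<close>

lemma module_hom_codomain_iff:
  assumes "A \<subseteq> carrier M"
  shows "\<phi> \<in> module_hom R M (M\<lparr>carrier := A\<rparr>) \<longleftrightarrow> \<phi> \<in> carrier E \<and> \<phi> ` carrier M \<subseteq> A"
  using assms by (auto simp: End_iff module_hom_def hom_def)

lemma restrict_module_hom:
  assumes "t \<in> carrier E" "submodule A R M"
  shows "restrict t A \<in> module_hom R (M\<lparr>carrier := A\<rparr>) M"
  using assms by (auto simp: submodule_iff module_hom_def hom_def End_add End_smult subset_iff)

text \<open>Composing with \<open>e\<close> first extends a homomorphism from eM to all of
  \<open>M\<close>.\<close>

lemma module_hom_extend:
  assumes e: "e \<in> idempotents E" and \<psi>: "\<psi> \<in> module_hom R (M\<lparr>carrier := e ` carrier M\<rparr>) M"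
  obtains t where "t \<in> carrier E" "\<psi> = restrict t (e ` carrier M)"
proof -
  note eE = idempotents_closed[OF e]
  have \<psi>ext: "\<psi> \<in> extensional (e ` carrier M)"
    and \<psi>cl: "\<And>x. x \<in> carrier M \<Longrightarrow> \<psi> (e x) \<in> carrier M"
    and \<psi>add: "\<And>x y. x \<in> carrier M \<Longrightarrow> y \<in> carrier M \<Longrightarrow> \<psi> (e x \<oplus>\<^bsub>M\<^esub> e y) = \<psi> (e x) \<oplus>\<^bsub>M\<^esub> \<psi> (e y)"
    and \<psi>smult: "\<And>r x. r \<in> carrier R \<Longrightarrow> x \<in> carrier M \<Longrightarrow> \<psi> (r \<odot>\<^bsub>M\<^esub> e x) = r \<odot>\<^bsub>M\<^esub> \<psi> (e x)"
    using \<psi> by (auto simp: module_hom_def hom_def)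
  have "(\<lambda>x \<in> carrier M. \<psi> (e x)) \<in> carrier E"
    unfolding End_iff by (auto simp: End_add End_smult eE \<psi>cl \<psi>add \<psi>smult)
  moreover have "\<psi> = restrict (\<lambda>x \<in> carrier M. \<psi> (e x)) (e ` carrier M)"
    using \<psi>ext eE e by (intro extensionalityI) (auto simp: idempotents_apply)
  ultimately show thesis by (rule that)
qed

text \<open>A splitting is replaced by an endomorphism \<open>t\<close> of \<open>M\<close> that
  restricts to it, so that it can appear in ring expressions such as ete.\<close>

lemma splitting_iff:
  assumes e: "e \<in> idempotents E"
  shows "splitting R M (M\<lparr>carrier := e ` carrier M\<rparr>) \<phi> \<psi> \<longleftrightarrow>
    (\<exists>t \<in> carrier E. \<psi> = restrict t (e ` carrier M) \<and> (\<forall>y \<in> e ` carrier M. \<phi> (t y) = y))"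
proof -
  have "submodule (e ` carrier M) R M"
    by (intro End_image_submodule idempotents_closed e submodule_carrier)
  then show ?thesis
    unfolding splitting_def
    by (auto intro: restrict_module_hom elim!: module_hom_extend[OF e])
qed

lemma split_epi_iff:
  assumes e: "e \<in> idempotents E"
  shows "split_epi R M (M\<lparr>carrier := e ` carrier M\<rparr>) \<phi> \<longleftrightarrow>
    \<phi> \<in> carrier E \<and> \<phi> ` carrier M = e ` carrier M \<and>
    (\<exists>t \<in> carrier E. \<forall>y \<in> e ` carrier M. \<phi> (t y) = y)"
proof -
  have "e ` carrier M \<subseteq> carrier M"
    using idempotents_closed[OF e] by auto
  then show ?thesis
    unfolding split_epi_def splitting_iff[OF e] by (auto simp: module_hom_codomain_iff)
qed

text \<open>The composite with \<open>e\<close> maps eM linearly into eM whatever \<open>t\<close>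
  is, so bijectivity is all that remains to be asked.\<close>

lemma compose_module_aut_iff:
  assumes e: "e \<in> idempotents E" and t: "t \<in> carrier E"
  shows "compose (e ` carrier M) e (restrict t (e ` carrier M)) \<in>
      module_aut R (M\<lparr>carrier := e ` carrier M\<rparr>) \<longleftrightarrow>
    bij_betw (\<lambda>y. e (t y)) (e ` carrier M) (e ` carrier M)" (is "?f \<in> _ \<longleftrightarrow> _")
proof -
  let ?A = "e ` carrier M"
  note eE = idempotents_closed[OF e]
  have sub: "submodule ?A R M"
    by (intro End_image_submodule eE submodule_carrier)
  then have "?f \<in> module_hom R (M\<lparr>carrier := ?A\<rparr>) (M\<lparr>carrier := ?A\<rparr>)"
    using t eE unfolding submodule_iff module_hom_def hom_def
    by (auto simp: compose_def End_add End_smult simp del: image_subset_iff)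
  moreover have "bij_betw ?f ?A ?A \<longleftrightarrow> bij_betw (\<lambda>y. e (t y)) ?A ?A"
    by (rule bij_betw_cong) (simp add: compose_def)
  ultimately show ?thesis
    by (simp add: module_aut_def)
qed

text \<open>The element ete vanishes on (1-e)M and acts on eM as \<open>e\<close> after
  \<open>t\<close>; in this way eSe is the endomorphism ring of eM, whose units are the
  bijections.\<close>

lemma corner_Units_iff:
  assumes e: "e \<in> idempotents E" and t: "t \<in> carrier E"
  shows "e \<otimes>\<^bsub>E\<^esub> t \<otimes>\<^bsub>E\<^esub> e \<in> Units (corner E e) \<longleftrightarrow>
    bij_betw (\<lambda>y. e (t y)) (e ` carrier M) (e ` carrier M)"
proof
  note eE = idempotents_closed[OF e]
  note ee = idempotents_apply[OF e]
  show "bij_betw (\<lambda>y. e (t y)) (e ` carrier M) (e ` carrier M)"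
    if "e \<otimes>\<^bsub>E\<^esub> t \<otimes>\<^bsub>E\<^esub> e \<in> Units (corner E e)"
  proof -
    from that obtain k where k: "k \<in> carrier E"
      and 1: "(e \<otimes>\<^bsub>E\<^esub> k \<otimes>\<^bsub>E\<^esub> e) \<otimes>\<^bsub>E\<^esub> (e \<otimes>\<^bsub>E\<^esub> t \<otimes>\<^bsub>E\<^esub> e) = e"
      and 2: "(e \<otimes>\<^bsub>E\<^esub> t \<otimes>\<^bsub>E\<^esub> e) \<otimes>\<^bsub>E\<^esub> (e \<otimes>\<^bsub>E\<^esub> k \<otimes>\<^bsub>E\<^esub> e) = e"
      by (auto simp: Units_def corner_def)
    have "e (k (e (t (e x)))) = e x" "e (t (e (k (e x)))) = e x" if "x \<in> carrier M" for x
      using arg_cong[OF 1, of "\<lambda>h. h x"] arg_cong[OF 2, of "\<lambda>h. h x"] that eE k t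
      by (simp_all add: ee)
    then show ?thesis
      using eE k t by (intro bij_betw_byWitness[where f' = "\<lambda>y. e (k y)"]) auto
  qed
  show "e \<otimes>\<^bsub>E\<^esub> t \<otimes>\<^bsub>E\<^esub> e \<in> Units (corner E e)"
    if bij: "bij_betw (\<lambda>y. e (t y)) (e ` carrier M) (e ` carrier M)"
  proof -
    \<comment> \<open>\<open>e t e\<close>, extended by the identity of \<open>(1 - e)M\<close>, is a unit \<open>h\<close>, and \<open>e h\<inverse> e\<close> inverts \<open>e t e\<close>\<close>
    define h where "h = e \<otimes>\<^bsub>E\<^esub> t \<otimes>\<^bsub>E\<^esub> e \<oplus>\<^bsub>E\<^esub> (\<one>\<^bsub>E\<^esub> \<ominus>\<^bsub>E\<^esub> e)"
    have hE: "h \<in> carrier E"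
      using eE t by (simp add: h_def)
    have h: "h x = e (t (e x)) \<oplus>\<^bsub>M\<^esub> (x \<ominus>\<^bsub>M\<^esub> e x)" if "x \<in> carrier M" for x
      using that eE t by (simp add: h_def)
    have eh: "e (h x) = e (t (e x))" if "x \<in> carrier M" for x
      using that eE t by (simp add: h End_add End_minus ee minus_self_eq_zero)
    have he: "h (e x) = e (t (e x))" if "x \<in> carrier M" for x
      using that eE t by (simp add: h ee minus_self_eq_zero)
    have "h \<in> Units E"
    proof (rule trivial_kernel_surj_Units[OF hE])
      fix x assume x: "x \<in> carrier M" and hx: "h x = \<zero>\<^bsub>M\<^esub>"
      \<comment> \<open>Applying \<open>e\<close> to \<open>h x = 0\<close> leaves only the first
        summand, so injectivity on eM gives \<open>e x = 0\<close>; then \<open>h x\<close> is x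
        itself.\<close>
      have "e (t (e x)) = e (t (e \<zero>\<^bsub>M\<^esub>))"
        unfolding eh[OF x, symmetric] hx using eE t by simp
      then have "e x = e \<zero>\<^bsub>M\<^esub>"
        by (rule inj_onD[OF bij_betw_imp_inj_on[OF bij]]) (use x in auto)
      then show "x = \<zero>\<^bsub>M\<^esub>"
        using h[OF x] hx minus_add_cancel[of x "\<zero>\<^bsub>M\<^esub>"] x eE t by simp
    next
      fix y assume y: "y \<in> carrier M"
      then have "e y \<in> (\<lambda>y. e (t y)) ` e ` carrier M"
        unfolding bij_betw_imp_surj_on[OF bij] by blast
      then obtain z where z: "z \<in> carrier M" "e (t (e z)) = e y"
        by auto
      \<comment> \<open>The preimage of y: \<open>h\<close> sends \<open>e z\<close> to
        \<open>e y\<close> and fixes \<open>y - e y\<close>, which lies in (1-e)M.\<close>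
      have "h (e z \<oplus>\<^bsub>M\<^esub> (y \<ominus>\<^bsub>M\<^esub> e y)) = h (e z) \<oplus>\<^bsub>M\<^esub> (h y \<ominus>\<^bsub>M\<^esub> h (e y))"
        using hE eE y z by (simp add: End_add End_minus)
      also have "\<dots> = e y \<oplus>\<^bsub>M\<^esub> ((e (t (e y)) \<oplus>\<^bsub>M\<^esub> (y \<ominus>\<^bsub>M\<^esub> e y)) \<ominus>\<^bsub>M\<^esub> e (t (e y)))"
        using y z by (simp add: he h)
      also have "\<dots> = y"
        using eE t y by (simp add: add_minus_cancel_left add_minus_cancel)
      finally show "\<exists>x \<in> carrier M. h x = y"
        by (rule bexI) (use eE y z in simp)
    qed
    then obtain w where w: "w \<in> carrier E" "\<And>x. x \<in> carrier M \<Longrightarrow> h (w x) = x"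
        "\<And>x. x \<in> carrier M \<Longrightarrow> w (h x) = x"
      by (rule Units_inverse) blast
    have "e (w (e (t (e x)))) = e x" "e (t (e (w (e x)))) = e x" if "x \<in> carrier M" for x
      using that he[of x] eh[of "w (e x)"] w eE by (simp_all add: ee flip: he)
    then have "(e \<otimes>\<^bsub>E\<^esub> w \<otimes>\<^bsub>E\<^esub> e) \<otimes>\<^bsub>E\<^esub> (e \<otimes>\<^bsub>E\<^esub> t \<otimes>\<^bsub>E\<^esub> e) = e"
      and "(e \<otimes>\<^bsub>E\<^esub> t \<otimes>\<^bsub>E\<^esub> e) \<otimes>\<^bsub>E\<^esub> (e \<otimes>\<^bsub>E\<^esub> w \<otimes>\<^bsub>E\<^esub> e) = e"
      using eE t w(1) by (auto intro!: End_eqI simp: ee)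
    then show ?thesis
      using eE t w(1) by (auto simp: Units_def corner_def)
  qed
qed

text \<open>The kernel of \<open>e\<close> is (1-e)M, so \<open>e\<close> is injective on the image
  of \<open>t\<close> iff that image meets (1-e)M trivially, and maps it onto eM iff the two span
  \<open>M\<close>. As \<open>t\<close> splits \<phi>, it is injective on eM, so the same criteria
  govern \<open>e\<close> after \<open>t\<close>. This links the conclusions of (4) and (5).\<close>

lemma bij_iff_complement:
  assumes e: "e \<in> idempotents E" and "\<phi> \<in> carrier E" and t: "t \<in> carrier E"
    and split: "\<And>y. y \<in> e ` carrier M \<Longrightarrow> \<phi> (t y) = y"
  shows "complement R M (t ` e ` carrier M) ((\<one>\<^bsub>E\<^esub> \<ominus>\<^bsub>E\<^esub> e) ` carrier M) \<longleftrightarrow>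
    bij_betw (\<lambda>y. e (t y)) (e ` carrier M) (e ` carrier M)" (is "?L \<longleftrightarrow> ?R")
proof
  note eE = idempotents_closed[OF e]
  note ee = idempotents_apply[OF e]
  have ker: "(\<one>\<^bsub>E\<^esub> \<ominus>\<^bsub>E\<^esub> e) ` carrier M = Ker e"
    by (rule idempotent_image_one_minus[OF e])
  have t0: "x = \<zero>\<^bsub>M\<^esub>" if "x \<in> e ` carrier M" "t x = \<zero>\<^bsub>M\<^esub>" for x
    using split[OF that(1)] that(2) assms(2) by simp
  show ?R if L: ?L
  proof (rule bij_betw_imageI)
    show "inj_on (\<lambda>y. e (t y)) (e ` carrier M)"
    proof (rule inj_onI)
      fix x y assume xy: "x \<in> e ` carrier M" "y \<in> e ` carrier M" "e (t x) = e (t y)"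
      then have M: "x \<in> carrier M" "y \<in> carrier M"
        using eE by auto
      have d: "x \<ominus>\<^bsub>M\<^esub> y \<in> e ` carrier M"
        by (intro submodule_minus[OF End_image_submodule[OF eE submodule_carrier]] xy)
      have "t (x \<ominus>\<^bsub>M\<^esub> y) \<in> Ker e"
        using M xy(3) t eE by (simp add: End_minus minus_self_eq_zero)
      then have "t (x \<ominus>\<^bsub>M\<^esub> y) = \<zero>\<^bsub>M\<^esub>"
        using L d unfolding ker complement_iff by blast
      then show "x = y"
        using t0[OF d] M by (simp add: minus_eq_zero_iff)
    qed
    have "e x \<in> (\<lambda>y. e (t y)) ` e ` carrier M" if x: "x \<in> carrier M" for x
    proof -
      obtain a c where ac: "a \<in> t ` e ` carrier M" "c \<in> Ker e" "x = a \<oplus>\<^bsub>M\<^esub> c"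
        by (rule complement_decompose[OF L[unfolded ker] x])
      then have "e x = e a"
        using t eE by (auto simp: End_add)
      then show ?thesis using ac(1) by blast
    qed
    then show "(\<lambda>y. e (t y)) ` e ` carrier M = e ` carrier M"
      using t eE by auto
  qed
  show ?L if R: ?R
    unfolding ker complement_iff
  proof (intro conjI ballI impI)
    show "submodule (t ` e ` carrier M) R M"
      by (intro End_image_submodule t eE submodule_carrier)
    show "submodule (Ker e) R M"
      by (rule End_kernel_submodule[OF eE])
    show "\<exists>a \<in> t ` e ` carrier M. \<exists>c \<in> Ker e. x = a \<oplus>\<^bsub>M\<^esub> c" if x: "x \<in> carrier M" for x
    proof -
      from x have "e x \<in> (\<lambda>y. e (t y)) ` e ` carrier M"
        unfolding bij_betw_imp_surj_on[OF R] by blast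
      then obtain z where z: "z \<in> carrier M" "e (t (e z)) = e x"
        by auto
      then have "x \<ominus>\<^bsub>M\<^esub> t (e z) \<in> Ker e"
        using x t eE by (simp add: End_minus minus_self_eq_zero)
      moreover have "x = t (e z) \<oplus>\<^bsub>M\<^esub> (x \<ominus>\<^bsub>M\<^esub> t (e z))"
        using x z t eE by (simp add: add_minus_cancel)
      ultimately show ?thesis using z(1) by blast
    qed
    show "x = \<zero>\<^bsub>M\<^esub>" if x: "x \<in> t ` e ` carrier M" "x \<in> Ker e" for x
    proof -
      obtain z where z: "z \<in> carrier M" "x = t (e z)"
        using x(1) by blast
      then have "e (t (e z)) = e (t (e \<zero>\<^bsub>M\<^esub>))"
        using x(2) t eE by simp
      then have "e z = e \<zero>\<^bsub>M\<^esub>"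
        by (rule inj_onD[OF bij_betw_imp_inj_on[OF R]]) (use z(1) in auto)
      then show ?thesis using z t eE by simp
    qed
  qed
qed

text \<open>The image of a splitting \<open>t\<close> complements the kernel by
  \<open>x = (x - t (\<phi> x)) + t (\<phi> x)\<close>. Conversely, a common complement
  \<open>L\<close> of the kernel and (1-e)M is the image of some splitting, found by correcting an
  arbitrary one.\<close>

lemma complement_splitting_iff_perspective:
  assumes e: "e \<in> idempotents E" and epi: "split_epi R M (M\<lparr>carrier := e ` carrier M\<rparr>) \<phi>"
  shows "(\<exists>t \<in> carrier E. (\<forall>y \<in> e ` carrier M. \<phi> (t y) = y) \<and>
      complement R M (t ` e ` carrier M) ((\<one>\<^bsub>E\<^esub> \<ominus>\<^bsub>E\<^esub> e) ` carrier M)) \<longleftrightarrow>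
    perspective R M (Ker \<phi>) ((\<one>\<^bsub>E\<^esub> \<ominus>\<^bsub>E\<^esub> e) ` carrier M)"
proof
  note eE = idempotents_closed[OF e]
  from epi obtain s where \<phi>: "\<phi> \<in> carrier E" "\<phi> ` carrier M = e ` carrier M"
    and s: "s \<in> carrier E" "\<And>y. y \<in> e ` carrier M \<Longrightarrow> \<phi> (s y) = y"
    unfolding split_epi_iff[OF e] by blast
  let ?C = "(\<one>\<^bsub>E\<^esub> \<ominus>\<^bsub>E\<^esub> e) ` carrier M"
  show "perspective R M (Ker \<phi>) ?C"
    if "\<exists>t \<in> carrier E. (\<forall>y \<in> e ` carrier M. \<phi> (t y) = y) \<and> complement R M (t ` e ` carrier M) ?C"
  proof -
    from that obtain t where t: "t \<in> carrier E" "\<And>y. y \<in> e ` carrier M \<Longrightarrow> \<phi> (t y) = y"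
      and tC: "complement R M (t ` e ` carrier M) ?C" by blast
    have "complement R M (Ker \<phi>) (t ` e ` carrier M)"
      unfolding complement_iff
    proof (intro conjI ballI impI)
      show "submodule (Ker \<phi>) R M" by (rule End_kernel_submodule[OF \<phi>(1)])
      show "submodule (t ` e ` carrier M) R M"
        by (intro End_image_submodule t(1) eE submodule_carrier)
      show "\<exists>a \<in> Ker \<phi>. \<exists>c \<in> t ` e ` carrier M. x = a \<oplus>\<^bsub>M\<^esub> c" if x: "x \<in> carrier M" for x
      proof -
        have *: "\<phi> x \<in> e ` carrier M" using x \<phi>(2) by blast
        then have "x \<ominus>\<^bsub>M\<^esub> t (\<phi> x) \<in> Ker \<phi>"
          using x t \<phi>(1) by (simp add: End_minus minus_self_eq_zero)
        moreover have "x = (x \<ominus>\<^bsub>M\<^esub> t (\<phi> x)) \<oplus>\<^bsub>M\<^esub> t (\<phi> x)"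
          using x t(1) \<phi>(1) by (simp add: minus_add_cancel)
        ultimately show ?thesis using * by blast
      qed
      show "x = \<zero>\<^bsub>M\<^esub>" if x: "x \<in> Ker \<phi>" "x \<in> t ` e ` carrier M" for x
        using x t by auto
    qed
    then show ?thesis
      using tC complement_sym unfolding perspective_iff by blast
  qed
  assume "perspective R M (Ker \<phi>) ?C"
  then obtain L where L: "complement R M (Ker \<phi>) L" "complement R M ?C L"
    unfolding perspective_iff by blast
  obtain p where p: "p \<in> idempotents E" "p ` carrier M = L"
    "(\<one>\<^bsub>E\<^esub> \<ominus>\<^bsub>E\<^esub> p) ` carrier M = Ker \<phi>"
    by (rule obtain_projection[OF complement_sym[OF L(1)]])
  note pE = idempotents_closed[OF p(1)]
  \<comment> \<open>The projection \<open>p\<close> changes x only by an element of the kernel of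
    \<phi>.\<close>
  have \<phi>p: "\<phi> (p x) = \<phi> x" if x: "x \<in> carrier M" for x
  proof -
    have "(\<one>\<^bsub>E\<^esub> \<ominus>\<^bsub>E\<^esub> p) x \<in> Ker \<phi>"
      using p(3) x by blast
    then have "\<phi> x \<ominus>\<^bsub>M\<^esub> \<phi> (p x) = \<zero>\<^bsub>M\<^esub>"
      using x pE \<phi>(1) by (simp add: End_minus)
    then show ?thesis
      using x pE \<phi>(1) by (simp add: minus_eq_zero_iff)
  qed
  have fix_L: "p l = l" if "l \<in> L" for l
    using that p(2) idempotents_apply[OF p(1)] by auto
  have pK: "p x = \<zero>\<^bsub>M\<^esub>" if "x \<in> Ker \<phi>" for x
    using that idempotent_image_one_minus[OF p(1)] p(3) by blast
  \<comment> \<open>the splitting with image \<open>L\<close>: move \<open>s y\<close> into \<open>L\<close> along \<open>Ker \<phi>\<close>\<close>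
  define t where "t = p \<otimes>\<^bsub>E\<^esub> s"
  have tE: "t \<in> carrier E" using pE s(1) by (simp add: t_def)
  have tp: "t y = p (s y)" if "y \<in> carrier M" for y
    using that by (simp add: t_def)
  have eM: "y \<in> carrier M" if "y \<in> e ` carrier M" for y
    using that eE by auto
  have split: "\<phi> (t y) = y" if "y \<in> e ` carrier M" for y
    using that s by (simp add: tp eM \<phi>p)
  moreover have "t ` e ` carrier M = L"
  proof (intro equalityI subsetI)
    fix x assume "x \<in> t ` e ` carrier M"
    then show "x \<in> L" using p(2) s(1) tp eM by force
  next
    fix l assume l: "l \<in> L"
    then have lM: "l \<in> carrier M" using complement_subset(2)[OF L(1)] by blast
    then have \<phi>l: "\<phi> l \<in> e ` carrier M" using \<phi>(2) by blast
    \<comment> \<open>Both \<open>s (\<phi> l)\<close> and \<open>l\<close> have the same image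
      under \<phi>, so \<open>p\<close> identifies them; since \<open>p\<close> fixes
      \<open>l\<close>, the splitting \<open>t\<close> takes \<open>\<phi> l\<close> back to
      \<open>l\<close>.\<close>
    then have "s (\<phi> l) \<ominus>\<^bsub>M\<^esub> l \<in> Ker \<phi>"
      using lM s \<phi>(1) by (simp add: End_minus minus_self_eq_zero)
    then have "p (s (\<phi> l)) \<ominus>\<^bsub>M\<^esub> p l = \<zero>\<^bsub>M\<^esub>"
      using pK lM s(1) \<phi>(1) pE by (simp flip: End_minus)
    then have "t (\<phi> l) = l"
      using lM s(1) \<phi>(1) pE l fix_L by (simp add: tp minus_eq_zero_iff)
    then show "l \<in> t ` e ` carrier M" using \<phi>l by (metis imageI)
  qed
  ultimately show "\<exists>t \<in> carrier E. (\<forall>y \<in> e ` carrier M. \<phi> (t y) = y) \<and>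
      complement R M (t ` e ` carrier M) ?C"
    using tE complement_sym[OF L(2)] by blast
qed

text \<open>\<open>X\<close> and \<open>Y\<close> are both complements of \<open>B\<close>, so
  projecting along \<open>B\<close> maps \<open>X\<close> isomorphically onto \<open>Y\<close>. The
  inverse is the projection onto \<open>X\<close> along \<open>B\<close>, which supplies the
  splitting \<open>s\<close>.\<close>

lemma split_epi_with_kernel:
  assumes AX: "complement R M A X" and BX: "complement R M B X" and YB: "complement R M Y B"
  obtains \<phi> s where "\<phi> \<in> carrier E" "s \<in> carrier E" "\<phi> ` carrier M = Y" "Ker \<phi> = A"
    "\<And>y. y \<in> Y \<Longrightarrow> \<phi> (s y) = y"
proof -
  obtain p where p: "p \<in> idempotents E" "p ` carrier M = X" "(\<one>\<^bsub>E\<^esub> \<ominus>\<^bsub>E\<^esub> p) ` carrier M = A"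
    by (rule obtain_projection[OF complement_sym[OF AX]])
  obtain q where q: "q \<in> idempotents E" "q ` carrier M = Y" "(\<one>\<^bsub>E\<^esub> \<ominus>\<^bsub>E\<^esub> q) ` carrier M = B"
    by (rule obtain_projection[OF YB])
  obtain s where s: "s \<in> idempotents E" "s ` carrier M = X" "(\<one>\<^bsub>E\<^esub> \<ominus>\<^bsub>E\<^esub> s) ` carrier M = B"
    by (rule obtain_projection[OF complement_sym[OF BX]])
  note pE = idempotents_closed[OF p(1)] and qE = idempotents_closed[OF q(1)]
    and sE = idempotents_closed[OF s(1)]
  have kp: "Ker p = A" and kq: "Ker q = B"
    using p q idempotent_image_one_minus by simp_all
  have ps: "p (s y) = s y" if "y \<in> carrier M" for y
    using that s(2) p(2) idempotents_apply[OF p(1)] by (metis imageE imageI)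
  \<comment> \<open>The points y and \<open>s y\<close> differ by an element of \<open>B\<close>,
    the kernel of \<open>q\<close>.\<close>
  have qs: "q (s y) = q y" if y: "y \<in> carrier M" for y
  proof -
    have "(\<one>\<^bsub>E\<^esub> \<ominus>\<^bsub>E\<^esub> s) y \<in> Ker q"
      using s(3) kq y by blast
    then have "q y \<ominus>\<^bsub>M\<^esub> q (s y) = \<zero>\<^bsub>M\<^esub>"
      using y sE qE by (simp add: End_minus)
    then show ?thesis
      using y sE qE by (simp add: minus_eq_zero_iff)
  qed
  define \<phi> where "\<phi> = q \<otimes>\<^bsub>E\<^esub> p"
  have \<phi>E: "\<phi> \<in> carrier E" using pE qE by (simp add: \<phi>_def)
  have \<phi>: "\<phi> x = q (p x)" if "x \<in> carrier M" for x using that by (simp add: \<phi>_def)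
  have YM: "Y \<subseteq> carrier M" by (rule complement_subset(1)[OF YB])
  have split: "\<phi> (s y) = y" if "y \<in> Y" for y
  proof -
    have y: "y \<in> carrier M" "q y = y"
      using that YM idempotent_image[OF q(1)] q(2) by auto
    then show ?thesis using sE by (simp add: \<phi> ps qs)
  qed
  have image: "\<phi> ` carrier M = Y"
  proof (intro equalityI subsetI)
    fix y assume "y \<in> \<phi> ` carrier M"
    then show "y \<in> Y" using pE q(2) by (auto simp: \<phi>)
  next
    fix y assume y: "y \<in> Y"
    then have "s y \<in> carrier M" using YM sE by blast
    then show "y \<in> \<phi> ` carrier M" using split[OF y] by (metis imageI)
  qed
  have "Ker \<phi> = A"
  proof (intro equalityI subsetI)
    fix x assume x: "x \<in> Ker \<phi>"
    \<comment> \<open>The projected point lies in both \<open>B\<close> and \<open>X\<close>, which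
      meet trivially.\<close>
    then have "p x \<in> Ker q" "p x \<in> X"
      using \<phi>[of x] pE p(2) by auto
    then have "p x = \<zero>\<^bsub>M\<^esub>"
      using BX unfolding kq complement_iff by blast
    then show "x \<in> A" using x kp by blast
  next
    fix x assume "x \<in> A"
    then have "x \<in> Ker p" using kp by simp
    then show "x \<in> Ker \<phi>" using qE by (simp add: \<phi>)
  qed
  with \<phi>E sE image show thesis using split by (rule that)
qed

subsection \<open>Special clean endomorphisms\<close>

text \<open>Let w be the inverse of v. From \<open>a = g + v\<close> follows aw = 1 + gw, and the
  trivial intersection of aS and gS then forces gwa = 0 and awg = 0. These two identities give
  \<open>M\<close> as the direct sum of aM and gM and also of the kernels of \<open>a\<close> and
  \<open>g\<close>; the kernel of \<open>g\<close> is the common complement.\<close>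

lemma special_clean_imp_perspective:
  assumes "special_clean E a"
  shows "\<exists>C. complement R M (a ` carrier M) C \<and> perspective R M (Ker a) C"
proof -
  obtain g v where aE: "a \<in> carrier E" and g: "g \<in> idempotents E" and v: "v \<in> Units E"
    and a_eq: "a = g \<oplus>\<^bsub>E\<^esub> v"
    and disj: "(a <#\<^bsub>E\<^esub> carrier E) \<inter> (g <#\<^bsub>E\<^esub> carrier E) = {\<zero>\<^bsub>E\<^esub>}"
    using assms by (auto simp: special_clean_def)
  note gE = idempotents_closed[OF g]
  note vE = End.Units_closed[OF v]
  obtain w where w: "w \<in> carrier E" "\<And>x. x \<in> carrier M \<Longrightarrow> v (w x) = x"
      "\<And>x. x \<in> carrier M \<Longrightarrow> w (v x) = x"
    by (rule Units_inverse[OF v]) blast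
  note [simp] = aE gE vE w(1)
  have a: "a x = g x \<oplus>\<^bsub>M\<^esub> v x" if "x \<in> carrier M" for x
    using that by (simp add: a_eq)
  have aw: "a (w x) = g (w x) \<oplus>\<^bsub>M\<^esub> x" if "x \<in> carrier M" for x
    using that by (simp add: a w)
  have disjD: "h = \<zero>\<^bsub>E\<^esub>" if "h = a \<otimes>\<^bsub>E\<^esub> r" "h = g \<otimes>\<^bsub>E\<^esub> s" "r \<in> carrier E" "s \<in> carrier E" for h r s
  proof -
    have "h \<in> (a <#\<^bsub>E\<^esub> carrier E) \<inter> (g <#\<^bsub>E\<^esub> carrier E)"
      using that unfolding l_coset_def by blast
    then show ?thesis unfolding disj by simp
  qed
  \<comment> \<open>Expand with aw = 1 + gw: the left side lies in aS and the right side in gS, so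
    both vanish. The second identity is treated alike.\<close>
  have eq1: "a \<otimes>\<^bsub>E\<^esub> (w \<otimes>\<^bsub>E\<^esub> a \<ominus>\<^bsub>E\<^esub> \<one>\<^bsub>E\<^esub>) = g \<otimes>\<^bsub>E\<^esub> (w \<otimes>\<^bsub>E\<^esub> a)"
    by (rule End_eqI) (simp_all add: End_minus aw add_minus_cancel_right)
  then have "a \<otimes>\<^bsub>E\<^esub> (w \<otimes>\<^bsub>E\<^esub> a \<ominus>\<^bsub>E\<^esub> \<one>\<^bsub>E\<^esub>) = \<zero>\<^bsub>E\<^esub>"
    by (rule disjD[OF refl]) simp_all
  then have gwa: "g (w (a x)) = \<zero>\<^bsub>M\<^esub>" if "x \<in> carrier M" for x
    using that eq1 mult_apply[of x g "w \<otimes>\<^bsub>E\<^esub> a"] by simp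
  have eq2: "a \<otimes>\<^bsub>E\<^esub> (w \<otimes>\<^bsub>E\<^esub> g) = g \<otimes>\<^bsub>E\<^esub> (w \<otimes>\<^bsub>E\<^esub> g \<oplus>\<^bsub>E\<^esub> \<one>\<^bsub>E\<^esub>)"
    by (rule End_eqI) (simp_all add: End_add aw)
  then have "a \<otimes>\<^bsub>E\<^esub> (w \<otimes>\<^bsub>E\<^esub> g) = \<zero>\<^bsub>E\<^esub>"
    by (rule disjD[OF refl]) simp_all
  then have awg: "a (w (g x)) = \<zero>\<^bsub>M\<^esub>" if "x \<in> carrier M" for x
    using that mult_apply[of x a "w \<otimes>\<^bsub>E\<^esub> g"] by simp
  \<comment> \<open>Combining awg = 0 with aw = 1 + gw gives gwg = -g, so -w acts as a section of
    \<open>g\<close> on gM.\<close>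
  have gwg: "g (w (g x)) = \<ominus>\<^bsub>M\<^esub> g x" if "x \<in> carrier M" for x
    using aw[of "g x"] awg[OF that] that by (simp add: M.minus_equality)
  have gid: "g (g x) = g x" if "x \<in> carrier M" for x
    by (rule idempotents_apply[OF g that])
  have "complement R M (a ` carrier M) (g ` carrier M)"
    unfolding complement_iff
  proof (intro conjI ballI impI)
    show "submodule (a ` carrier M) R M" "submodule (g ` carrier M) R M"
      by (intro End_image_submodule submodule_carrier aE gE)+
    show "\<exists>y \<in> a ` carrier M. \<exists>z \<in> g ` carrier M. x = y \<oplus>\<^bsub>M\<^esub> z" if x: "x \<in> carrier M" for x
    proof -
      \<comment> \<open>This is aw = 1 + gw solved for x.\<close>
      have "x = a (w x) \<oplus>\<^bsub>M\<^esub> g (\<ominus>\<^bsub>M\<^esub> w x)"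
        using x add_minus_cancel_left[of "g (w x)" x] by (simp add: aw End_uminus a_minus_def)
      then show ?thesis using x w(1) by blast
    qed
    show "x = \<zero>\<^bsub>M\<^esub>" if "x \<in> a ` carrier M" "x \<in> g ` carrier M" for x
    proof -
      have x: "x \<in> carrier M" "g x = x"
        using that(2) idempotent_image[OF g] by auto
      moreover have "g (w x) = \<zero>\<^bsub>M\<^esub>"
        using that(1) gwa by auto
      \<comment> \<open>For x in gM the identity gwg = -g turns \<open>g (w x)\<close> into -x,
        while for x in aM it is zero.\<close>
      ultimately have "\<ominus>\<^bsub>M\<^esub> x = \<zero>\<^bsub>M\<^esub>"
        using gwg[OF x(1)] by simp
      then show ?thesis using x(1) by (metis M.l_neg M.l_zero)
    qed
  qed
  moreover have "complement R M (Ker a) (Ker g)"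
    unfolding complement_iff
  proof (intro conjI ballI impI)
    show "submodule (Ker a) R M" "submodule (Ker g) R M"
      by (intro End_kernel_submodule aE gE)+
    show "\<exists>y \<in> Ker a. \<exists>z \<in> Ker g. x = y \<oplus>\<^bsub>M\<^esub> z" if x: "x \<in> carrier M" for x
    proof -
      \<comment> \<open>This point lies in the kernel of \<open>a\<close> since awg = 0, and
        \<open>g\<close> takes the same value on it as on x since gwg = -g.\<close>
      define k where "k = \<ominus>\<^bsub>M\<^esub> w (g x)"
      have k: "k \<in> carrier M" "a k = \<zero>\<^bsub>M\<^esub>" "g k = g x"
        using x by (simp_all add: k_def End_uminus awg gwg)
      then have "x \<ominus>\<^bsub>M\<^esub> k \<in> Ker g"
        using x by (simp add: End_minus minus_self_eq_zero)
      moreover have "x = k \<oplus>\<^bsub>M\<^esub> (x \<ominus>\<^bsub>M\<^esub> k)"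
        using x k(1) by (simp add: add_minus_cancel)
      ultimately show ?thesis using k by blast
    qed
    show "x = \<zero>\<^bsub>M\<^esub>" if "x \<in> Ker a" "x \<in> Ker g" for x
    proof -
      have "x \<in> carrier M" "v x = \<zero>\<^bsub>M\<^esub>"
        using that a[of x] by simp_all
      then show ?thesis using w(3)[of x] by simp
    qed
  qed
  moreover have "complement R M (g ` carrier M) (Ker g)"
    using idempotent_complement[OF g] unfolding idempotent_image_one_minus[OF g] .
  ultimately show ?thesis
    unfolding perspective_iff by blast
qed

text \<open>Let \<open>g\<close> project onto \<open>C\<close> along a common complement of
  \<open>C\<close> and the kernel of \<phi>. Then \<open>M\<close> is the direct sum of the kernels
  of \<phi> and \<open>g\<close>, so x is determined by the pair of its images, and these can be
  prescribed independently. The last two conclusions record this.\<close>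

lemma perspective_kernel_projection:
  assumes \<phi>: "\<phi> \<in> carrier E" and AC: "complement R M (\<phi> ` carrier M) C"
    and KC: "perspective R M (Ker \<phi>) C"
  obtains g where "g \<in> idempotents E" "complement R M (\<phi> ` carrier M) (g ` carrier M)"
    "\<And>x. x \<in> carrier M \<Longrightarrow> \<phi> x = \<zero>\<^bsub>M\<^esub> \<Longrightarrow> g x = \<zero>\<^bsub>M\<^esub> \<Longrightarrow> x = \<zero>\<^bsub>M\<^esub>"
    "\<And>y z. y \<in> carrier M \<Longrightarrow> z \<in> carrier M \<Longrightarrow> \<exists>x \<in> carrier M. \<phi> x = \<phi> y \<and> g x = g z"
proof -
  obtain X where X: "complement R M (Ker \<phi>) X" "complement R M C X"
    using KC unfolding perspective_iff by blast
  obtain g where g: "g \<in> idempotents E" "g ` carrier M = C" "(\<one>\<^bsub>E\<^esub> \<ominus>\<^bsub>E\<^esub> g) ` carrier M = X"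
    by (rule obtain_projection[OF X(2)])
  note gE = idempotents_closed[OF g(1)]
  have kg: "Ker g = X"
    using g idempotent_image_one_minus by simp
  show thesis
  proof (rule that[OF g(1)])
    show "complement R M (\<phi> ` carrier M) (g ` carrier M)"
      using AC g(2) by simp
    show "x = \<zero>\<^bsub>M\<^esub>" if "x \<in> carrier M" "\<phi> x = \<zero>\<^bsub>M\<^esub>" "g x = \<zero>\<^bsub>M\<^esub>" for x
      using that X(1) unfolding kg[symmetric] complement_iff by blast
    show "\<exists>x \<in> carrier M. \<phi> x = \<phi> y \<and> g x = g z" if yz: "y \<in> carrier M" "z \<in> carrier M" for y z
    proof -
      obtain k x where y: "k \<in> Ker \<phi>" "x \<in> Ker g" "y = k \<oplus>\<^bsub>M\<^esub> x"
        by (rule complement_decompose[OF X(1)[folded kg] yz(1)])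
      obtain l x' where z: "l \<in> Ker \<phi>" "x' \<in> Ker g" "z = l \<oplus>\<^bsub>M\<^esub> x'"
        by (rule complement_decompose[OF X(1)[folded kg] yz(2)])
      show ?thesis
        \<comment> \<open>Here \<open>l\<close> carries the value of \<open>g\<close> and x the
          value of \<phi>; each is killed by the other map.\<close>
        using y z \<phi> gE by (intro bexI[of _ "l \<oplus>\<^bsub>M\<^esub> x"]) (simp_all add: End_add)
    qed
  qed
qed

text \<open>The unit is \<open>\<phi> - g\<close>. If it kills x, then \<open>\<phi> x = g x\<close>
  lies in both images and is zero, so x is zero. Surjectivity comes from prescribing the two values
  independently, and disjointness of the right ideals from that of the images.\<close>

lemma perspective_imp_special_clean:
  assumes \<phi>: "\<phi> \<in> carrier E" and AC: "complement R M (\<phi> ` carrier M) C"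
    and KC: "perspective R M (Ker \<phi>) C"
  shows "special_clean E \<phi>"
proof -
  obtain g where g: "g \<in> idempotents E" and gC: "complement R M (\<phi> ` carrier M) (g ` carrier M)"
    and ker: "\<And>x. x \<in> carrier M \<Longrightarrow> \<phi> x = \<zero>\<^bsub>M\<^esub> \<Longrightarrow> g x = \<zero>\<^bsub>M\<^esub> \<Longrightarrow> x = \<zero>\<^bsub>M\<^esub>"
    and surj: "\<And>y z. y \<in> carrier M \<Longrightarrow> z \<in> carrier M \<Longrightarrow> \<exists>x \<in> carrier M. \<phi> x = \<phi> y \<and> g x = g z"
    by (rule perspective_kernel_projection[OF assms]) blast
  note gE = idempotents_closed[OF g]
  note [simp] = \<phi> gE
  have inter: "\<phi> x = \<zero>\<^bsub>M\<^esub>" if "\<phi> x = g y" "x \<in> carrier M" "y \<in> carrier M" for x y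
    using gC that unfolding complement_iff by blast
  have "\<phi> \<ominus>\<^bsub>E\<^esub> g \<in> Units E"
  proof (rule trivial_kernel_surj_Units)
    show "x = \<zero>\<^bsub>M\<^esub>" if x: "x \<in> carrier M" "(\<phi> \<ominus>\<^bsub>E\<^esub> g) x = \<zero>\<^bsub>M\<^esub>" for x
    proof -
      have "\<phi> x = g x" using x by (simp add: minus_eq_zero_iff)
      with inter[of x x] x(1) ker show ?thesis by metis
    qed
    show "\<exists>x \<in> carrier M. (\<phi> \<ominus>\<^bsub>E\<^esub> g) x = y" if y: "y \<in> carrier M" for y
    proof -
      obtain b c where bc: "b \<in> \<phi> ` carrier M" "c \<in> g ` carrier M" "y = b \<oplus>\<^bsub>M\<^esub> c"
        by (rule complement_decompose[OF gC y])
      then obtain m n where mn: "m \<in> carrier M" "n \<in> carrier M" "b = \<phi> m" "c = g n"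
        by blast
      \<comment> \<open>The minus sign compensates for subtracting \<open>g\<close>.\<close>
      then obtain x where x: "x \<in> carrier M" "\<phi> x = \<phi> m" "g x = g (\<ominus>\<^bsub>M\<^esub> n)"
        using surj[of m "\<ominus>\<^bsub>M\<^esub> n"] by auto
      then have "(\<phi> \<ominus>\<^bsub>E\<^esub> g) x = y"
        using mn bc(3) by (simp add: End_uminus a_minus_def[of M])
      then show ?thesis using x(1) by blast
    qed
  qed simp
  moreover have "\<phi> = g \<oplus>\<^bsub>E\<^esub> (\<phi> \<ominus>\<^bsub>E\<^esub> g)"
    by (rule End_eqI) (simp_all add: add_minus_cancel)
  moreover have "(\<phi> <#\<^bsub>E\<^esub> carrier E) \<inter> (g <#\<^bsub>E\<^esub> carrier E) = {\<zero>\<^bsub>E\<^esub>}"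
  proof (intro equalityI subsetI)
    fix h assume "h \<in> (\<phi> <#\<^bsub>E\<^esub> carrier E) \<inter> (g <#\<^bsub>E\<^esub> carrier E)"
    then obtain r s where rs: "r \<in> carrier E" "s \<in> carrier E" "h = \<phi> \<otimes>\<^bsub>E\<^esub> r" "h = g \<otimes>\<^bsub>E\<^esub> s"
      by (auto simp: l_coset_def)
    have "h x = \<zero>\<^bsub>M\<^esub>" if x: "x \<in> carrier M" for x
    proof -
      have "h x = \<phi> (r x)" "h x = g (s x)"
        using x mult_apply rs(3,4) by metis+
      then show ?thesis
        using inter[of "r x" "s x"] x rs(1,2) by simp
    qed
    then have "h = \<zero>\<^bsub>E\<^esub>"
      using rs(1,3) by (intro End_eqI) auto
    then show "h \<in> {\<zero>\<^bsub>E\<^esub>}" by simp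
  next
    fix h assume "h \<in> {\<zero>\<^bsub>E\<^esub>}"
    then have "h = \<phi> \<otimes>\<^bsub>E\<^esub> \<zero>\<^bsub>E\<^esub>" "h = g \<otimes>\<^bsub>E\<^esub> \<zero>\<^bsub>E\<^esub>" by simp_all
    then show "h \<in> (\<phi> <#\<^bsub>E\<^esub> carrier E) \<inter> (g <#\<^bsub>E\<^esub> carrier E)"
      unfolding l_coset_def by blast
  qed
  ultimately show ?thesis
    using g \<phi> unfolding special_clean_def by blast
qed

text \<open>Both gM and (1-e)M are complements of eM, so \<open>1 - e\<close> maps gM bijectively
  onto (1-e)M. Hence the eM-component \<open>\<phi> x\<close> and the (1-e)M-component of
  \<open>u x\<close> together determine x and can be prescribed; \<open>e\<close> retains only the
  first.\<close>

lemma perspective_kernel_unit_factor: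
  assumes e: "e \<in> idempotents E" and \<phi>: "\<phi> \<in> carrier E" and im: "\<phi> ` carrier M = e ` carrier M"
    and AC: "complement R M (e ` carrier M) C" and KC: "perspective R M (Ker \<phi>) C"
  obtains u where "u \<in> Units E" "e \<otimes>\<^bsub>E\<^esub> u = \<phi>"
proof -
  obtain g where g: "g \<in> idempotents E" and gC: "complement R M (\<phi> ` carrier M) (g ` carrier M)"
    and ker: "\<And>x. x \<in> carrier M \<Longrightarrow> \<phi> x = \<zero>\<^bsub>M\<^esub> \<Longrightarrow> g x = \<zero>\<^bsub>M\<^esub> \<Longrightarrow> x = \<zero>\<^bsub>M\<^esub>"
    and surj: "\<And>y z. y \<in> carrier M \<Longrightarrow> z \<in> carrier M \<Longrightarrow> \<exists>x \<in> carrier M. \<phi> x = \<phi> y \<and> g x = g z"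
    by (rule perspective_kernel_projection[OF \<phi> AC[folded im] KC]) blast
  note [simp] = \<phi> idempotents_closed[OF g] idempotents_closed[OF e]
  note ee = idempotents_apply[OF e]
  have e\<phi>: "e (\<phi> x) = \<phi> x" if "x \<in> carrier M" for x
    using that im idempotent_image[OF e] by blast
  define u where "u = \<phi> \<oplus>\<^bsub>E\<^esub> (\<one>\<^bsub>E\<^esub> \<ominus>\<^bsub>E\<^esub> e) \<otimes>\<^bsub>E\<^esub> g"
  have uE: "u \<in> carrier E" by (simp add: u_def)
  have u: "u x = \<phi> x \<oplus>\<^bsub>M\<^esub> (g x \<ominus>\<^bsub>M\<^esub> e (g x))" if "x \<in> carrier M" for x
    using that by (simp add: u_def)
  have eu: "e (u x) = \<phi> x" if "x \<in> carrier M" for x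
    using that by (simp add: u End_add End_minus ee e\<phi> minus_self_eq_zero)
  have "u \<in> Units E"
  proof (rule trivial_kernel_surj_Units[OF uE])
    fix x assume x: "x \<in> carrier M" "u x = \<zero>\<^bsub>M\<^esub>"
    have \<phi>x: "\<phi> x = \<zero>\<^bsub>M\<^esub>"
      unfolding eu[OF x(1), symmetric] x(2) by simp
    then have "g x \<ominus>\<^bsub>M\<^esub> e (g x) = \<zero>\<^bsub>M\<^esub>"
      using u[OF x(1)] x by simp
    then have "g x = e (g x)"
      using x(1) by (simp add: minus_eq_zero_iff)
    then have "g x \<in> \<phi> ` carrier M" "g x \<in> g ` carrier M"
      using x(1) im by (metis End_closed imageI idempotents_closed[OF g], blast)
    then have "g x = \<zero>\<^bsub>M\<^esub>"
      using gC unfolding complement_iff by blast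
    with x(1) \<phi>x show "x = \<zero>\<^bsub>M\<^esub>" by (rule ker)
  next
    fix y assume y: "y \<in> carrier M"
    obtain b c where bc: "b \<in> \<phi> ` carrier M" "c \<in> g ` carrier M" "y = b \<oplus>\<^bsub>M\<^esub> c"
      by (rule complement_decompose[OF gC y])
    then obtain n where n: "n \<in> carrier M" "c = g n" by blast
    have "e y \<in> \<phi> ` carrier M" using y im by simp
    then obtain m where m: "m \<in> carrier M" "\<phi> m = e y" by auto
    \<comment> \<open>Choose both components: \<open>b\<close> lies in eM, so \<open>c\<close> and y
      have the same component in (1-e)M, and \<open>u x\<close> becomes
      \<open>e y + (y - e y)\<close>.\<close>
    obtain x where x: "x \<in> carrier M" "\<phi> x = e y" "g x = c"
      using surj[of m n] m n by auto
    have b: "b \<in> carrier M" "e b = b"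
      using bc(1) e\<phi> by auto
    then have "y \<ominus>\<^bsub>M\<^esub> e y = c \<ominus>\<^bsub>M\<^esub> e c"
      using n bc(3) by (simp add: End_add add_minus_add_cancel)
    then have "u x = e y \<oplus>\<^bsub>M\<^esub> (y \<ominus>\<^bsub>M\<^esub> e y)"
      using x u[OF x(1)] by simp
    then show "\<exists>x \<in> carrier M. u x = y"
      using x(1) y by (auto simp: add_minus_cancel)
  qed
  moreover have "e \<otimes>\<^bsub>E\<^esub> u = \<phi>"
    using uE by (intro End_eqI) (simp_all add: eu)
  ultimately show thesis by (rule that)
qed

subsection \<open>Transitivity of perspectivity\<close>

lemma ex_splitting_complement_iff:
  assumes e: "e \<in> idempotents E" and epi: "split_epi R M (M\<lparr>carrier := e ` carrier M\<rparr>) \<phi>"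
  shows "(\<exists>\<psi>. splitting R M (M\<lparr>carrier := e ` carrier M\<rparr>) \<phi> \<psi> \<and>
      complement R M (\<psi> ` (e ` carrier M)) ((\<one>\<^bsub>E\<^esub> \<ominus>\<^bsub>E\<^esub> e) ` carrier M)) \<longleftrightarrow>
    perspective R M (Ker \<phi>) ((\<one>\<^bsub>E\<^esub> \<ominus>\<^bsub>E\<^esub> e) ` carrier M)"
  unfolding complement_splitting_iff_perspective[OF e epi, symmetric] splitting_iff[OF e]
  by (metis image_restrict_eq)

lemma ex_splitting_aut_iff:
  assumes e: "e \<in> idempotents E" and epi: "split_epi R M (M\<lparr>carrier := e ` carrier M\<rparr>) \<phi>"
  shows "(\<exists>\<psi>. splitting R M (M\<lparr>carrier := e ` carrier M\<rparr>) \<phi> \<psi> \<and>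
      compose (e ` carrier M) e \<psi> \<in> module_aut R (M\<lparr>carrier := e ` carrier M\<rparr>)) \<longleftrightarrow>
    (\<exists>t \<in> carrier E. (\<forall>y \<in> e ` carrier M. \<phi> (t y) = y) \<and>
      bij_betw (\<lambda>y. e (t y)) (e ` carrier M) (e ` carrier M))"
  unfolding splitting_iff[OF e] using compose_module_aut_iff[OF e] by blast

text \<open>By \<open>bij_iff_complement\<close>, the automorphism condition is the complement
  condition, hence equivalent to the same perspectivity.\<close>

lemma ex_splitting_aut_iff_perspective:
  assumes e: "e \<in> idempotents E" and epi: "split_epi R M (M\<lparr>carrier := e ` carrier M\<rparr>) \<phi>"
  shows "(\<exists>t \<in> carrier E. (\<forall>y \<in> e ` carrier M. \<phi> (t y) = y) \<and>
      bij_betw (\<lambda>y. e (t y)) (e ` carrier M) (e ` carrier M)) \<longleftrightarrow>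
    perspective R M (Ker \<phi>) ((\<one>\<^bsub>E\<^esub> \<ominus>\<^bsub>E\<^esub> e) ` carrier M)"
proof -
  have "\<phi> \<in> carrier E"
    using epi by (simp add: split_epi_iff[OF e])
  then show ?thesis
    unfolding complement_splitting_iff_perspective[OF e epi, symmetric]
    using bij_iff_complement[OF e] by blast
qed

text \<open>The ring equation is tested on points of eM only, because of its right factor
  \<open>e\<close>. With \<open>a = eu\<close> it says that \<open>t\<close> restricts to a
  splitting.\<close>

lemma corner_right_inverse_iff:
  assumes e: "e \<in> idempotents E" and a: "a \<in> carrier E" and t: "t \<in> carrier E"
  shows "a \<otimes>\<^bsub>E\<^esub> t \<otimes>\<^bsub>E\<^esub> e = e \<longleftrightarrow> (\<forall>y \<in> e ` carrier M. a (t y) = y)"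
proof
  note eE = idempotents_closed[OF e]
  show "\<forall>y \<in> e ` carrier M. a (t y) = y" if "a \<otimes>\<^bsub>E\<^esub> t \<otimes>\<^bsub>E\<^esub> e = e"
  proof -
    have "a (t (e x)) = e x" if "x \<in> carrier M" for x
      using arg_cong[OF \<open>a \<otimes>\<^bsub>E\<^esub> t \<otimes>\<^bsub>E\<^esub> e = e\<close>, of "\<lambda>h. h x"] that eE by simp
    then show ?thesis by blast
  qed
  show "a \<otimes>\<^bsub>E\<^esub> t \<otimes>\<^bsub>E\<^esub> e = e" if "\<forall>y \<in> e ` carrier M. a (t y) = y"
    using that eE a t by (intro End_eqI) auto
qed

lemma transitive_iff_kernel_perspective:
  "perspectivity_transitive R M \<longleftrightarrow>
    (\<forall>e \<in> idempotents E. \<forall>\<phi>. split_epi R M (M\<lparr>carrier := e ` carrier M\<rparr>) \<phi> \<longrightarrow>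
      (\<exists>C. complement R M (e ` carrier M) C \<and> perspective R M (Ker \<phi>) C) \<longrightarrow>
      perspective R M (Ker \<phi>) ((\<one>\<^bsub>E\<^esub> \<ominus>\<^bsub>E\<^esub> e) ` carrier M))" (is "_ \<longleftrightarrow> ?Q")
proof
  assume trans: "perspectivity_transitive R M"
  show ?Q
  proof (intro ballI allI impI)
    fix e \<phi> assume e: "e \<in> idempotents E"
    assume "\<exists>C. complement R M (e ` carrier M) C \<and> perspective R M (Ker \<phi>) C"
    then obtain C where C: "complement R M (e ` carrier M) C" "perspective R M (Ker \<phi>) C" by blast
    \<comment> \<open>The summand eM is a common complement of \<open>C\<close> and (1-e)M.\<close>
    then have "perspective R M C ((\<one>\<^bsub>E\<^esub> \<ominus>\<^bsub>E\<^esub> e) ` carrier M)"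
      using idempotent_complement[OF e] complement_sym unfolding perspective_iff by blast
    with trans C(2) show "perspective R M (Ker \<phi>) ((\<one>\<^bsub>E\<^esub> \<ominus>\<^bsub>E\<^esub> e) ` carrier M)"
      unfolding perspectivity_transitive_def perspective_def by blast
  qed
next
  assume Q: ?Q
  show "perspectivity_transitive R M"
    unfolding perspectivity_transitive_def
  proof (intro allI impI)
    fix A B C assume "perspective R M A B" "perspective R M B C"
    then obtain X Y where AX: "complement R M A X" and BX: "complement R M B X"
      and BY: "complement R M B Y" and CY: "complement R M C Y"
      unfolding perspective_iff by blast
    obtain e where e: "e \<in> idempotents E" "e ` carrier M = Y" "(\<one>\<^bsub>E\<^esub> \<ominus>\<^bsub>E\<^esub> e) ` carrier M = C"
      by (rule obtain_projection[OF complement_sym[OF CY]])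
    obtain \<phi> s where \<phi>: "\<phi> \<in> carrier E" "s \<in> carrier E" "\<phi> ` carrier M = Y" "Ker \<phi> = A"
      "\<And>y. y \<in> Y \<Longrightarrow> \<phi> (s y) = y"
      by (rule split_epi_with_kernel[OF AX BX complement_sym[OF BY]]) blast
    have "split_epi R M (M\<lparr>carrier := e ` carrier M\<rparr>) \<phi>"
      unfolding split_epi_iff[OF e(1)] unfolding e(2) by (intro conjI bexI[of _ s] ballI \<phi>)
    \<comment> \<open>The middle term \<open>B\<close> of the chain is the complement of eM that the
      hypothesis calls for.\<close>
    moreover have "complement R M (e ` carrier M) B \<and> perspective R M (Ker \<phi>) B"
      unfolding e(2) \<phi>(4) by (intro conjI complement_sym[OF BY] \<open>perspective R M A B\<close>)
    ultimately have "perspective R M (Ker \<phi>) ((\<one>\<^bsub>E\<^esub> \<ominus>\<^bsub>E\<^esub> e) ` carrier M)"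
      using Q e(1) by blast
    then show "perspective R M A C"
      unfolding e(3) \<phi>(4) .
  qed
qed

text \<open>For a common complement \<open>X\<close> of \<open>A\<close> and \<open>B\<close>, the
  chain from \<open>C\<close> over \<open>X\<close> to \<open>D\<close> consists of perspective
  steps: the first has common complement \<open>A\<close>, the second \<open>B\<close>.\<close>

lemma transitive_imp_complements_perspective:
  assumes trans: "perspectivity_transitive R M" and AB: "perspective R M A B"
    and AC: "complement R M A C" and BD: "complement R M B D"
  shows "perspective R M C D"
proof -
  obtain X where "complement R M A X" "complement R M B X"
    using AB unfolding perspective_iff by blast
  then have "perspective R M C X" "perspective R M X D"
    using AC BD complement_sym unfolding perspective_iff by blast+
  with trans show ?thesis
    unfolding perspectivity_transitive_def perspective_def by blast
qed

text \<open>In a chain from \<open>A\<close> over \<open>B\<close> to \<open>C\<close>, the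
  connecting complements \<open>X\<close> and \<open>Y\<close> share the complement
  \<open>B\<close>. Passing from \<open>X\<close> and \<open>Y\<close> to their complements
  \<open>A\<close> and \<open>C\<close> gives the claim.\<close>

lemma transitive_if_complements_perspective:
  assumes *: "\<forall>e \<in> idempotents E. \<forall>f \<in> idempotents E.
    perspective R M (f ` carrier M) (e ` carrier M) \<longrightarrow>
    perspective R M ((\<one>\<^bsub>E\<^esub> \<ominus>\<^bsub>E\<^esub> f) ` carrier M) ((\<one>\<^bsub>E\<^esub> \<ominus>\<^bsub>E\<^esub> e) ` carrier M)"
  shows "perspectivity_transitive R M"
  unfolding perspectivity_transitive_def
proof (intro allI impI)
  fix A B C assume "perspective R M A B" "perspective R M B C"
  then obtain X Y where AX: "complement R M A X" and BX: "complement R M B X"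
    and BY: "complement R M B Y" and CY: "complement R M C Y"
    unfolding perspective_iff by blast
  obtain f where f: "f \<in> idempotents E" "f ` carrier M = X" "(\<one>\<^bsub>E\<^esub> \<ominus>\<^bsub>E\<^esub> f) ` carrier M = A"
    by (rule obtain_projection[OF complement_sym[OF AX]])
  obtain e where e: "e \<in> idempotents E" "e ` carrier M = Y" "(\<one>\<^bsub>E\<^esub> \<ominus>\<^bsub>E\<^esub> e) ` carrier M = C"
    by (rule obtain_projection[OF complement_sym[OF CY]])
  have "perspective R M X Y"
    using BX BY complement_sym unfolding perspective_iff by blast
  then show "perspective R M A C"
    using * e f by metis
qed

text \<open>The two sides range over the same maps: an admissible \<phi> factors as eu and is
  special clean, while eu has image eM and, being special clean, satisfies the kernel hypothesis.
  The conclusions match by \<open>corner_right_inverse_iff\<close> and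
  \<open>corner_Units_iff\<close>.\<close>

lemma special_clean_condition_iff:
  "(\<forall>e \<in> idempotents E. \<forall>s \<in> carrier E. \<forall>u \<in> Units E.
      e \<otimes>\<^bsub>E\<^esub> u \<otimes>\<^bsub>E\<^esub> s \<otimes>\<^bsub>E\<^esub> e = e \<longrightarrow> special_clean E (e \<otimes>\<^bsub>E\<^esub> u) \<longrightarrow>
      (\<exists>t \<in> carrier E. e \<otimes>\<^bsub>E\<^esub> u \<otimes>\<^bsub>E\<^esub> t \<otimes>\<^bsub>E\<^esub> e = e \<and>
         e \<otimes>\<^bsub>E\<^esub> t \<otimes>\<^bsub>E\<^esub> e \<in> Units (corner E e))) \<longleftrightarrow>
   (\<forall>e \<in> idempotents E. \<forall>\<phi>. split_epi R M (M\<lparr>carrier := e ` carrier M\<rparr>) \<phi> \<longrightarrow>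
      (\<exists>C. complement R M (e ` carrier M) C \<and> perspective R M (Ker \<phi>) C) \<longrightarrow>
      (\<exists>t \<in> carrier E. (\<forall>y \<in> e ` carrier M. \<phi> (t y) = y) \<and>
        bij_betw (\<lambda>y. e (t y)) (e ` carrier M) (e ` carrier M)))" (is "?L \<longleftrightarrow> ?R")
proof
  assume L: ?L
  show ?R
  proof (intro ballI allI impI)
    fix e \<phi> assume e: "e \<in> idempotents E"
      and epi: "split_epi R M (M\<lparr>carrier := e ` carrier M\<rparr>) \<phi>"
      and "\<exists>C. complement R M (e ` carrier M) C \<and> perspective R M (Ker \<phi>) C"
    then obtain C where C: "complement R M (e ` carrier M) C" "perspective R M (Ker \<phi>) C" by blast
    obtain s where \<phi>: "\<phi> \<in> carrier E" "\<phi> ` carrier M = e ` carrier M"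
      and s: "s \<in> carrier E" "\<forall>y \<in> e ` carrier M. \<phi> (s y) = y"
      using epi unfolding split_epi_iff[OF e] by blast
    obtain u where u: "u \<in> Units E" "e \<otimes>\<^bsub>E\<^esub> u = \<phi>"
      by (rule perspective_kernel_unit_factor[OF e \<phi> C])
    have "special_clean E \<phi>"
      by (rule perspective_imp_special_clean[OF \<phi>(1) C(1)[folded \<phi>(2)] C(2)])
    moreover have "\<phi> \<otimes>\<^bsub>E\<^esub> s \<otimes>\<^bsub>E\<^esub> e = e"
      using s corner_right_inverse_iff[OF e \<phi>(1)] by blast
    ultimately obtain t where "t \<in> carrier E" "\<phi> \<otimes>\<^bsub>E\<^esub> t \<otimes>\<^bsub>E\<^esub> e = e"
        "e \<otimes>\<^bsub>E\<^esub> t \<otimes>\<^bsub>E\<^esub> e \<in> Units (corner E e)"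
      using L e s(1) u by metis
    then show "\<exists>t \<in> carrier E. (\<forall>y \<in> e ` carrier M. \<phi> (t y) = y) \<and>
        bij_betw (\<lambda>y. e (t y)) (e ` carrier M) (e ` carrier M)"
      using corner_right_inverse_iff[OF e \<phi>(1)] corner_Units_iff[OF e] by blast
  qed
next
  assume R: ?R
  show ?L
  proof (intro ballI impI)
    fix e s u assume e: "e \<in> idempotents E" and s: "s \<in> carrier E" and u: "u \<in> Units E"
      and inv: "e \<otimes>\<^bsub>E\<^esub> u \<otimes>\<^bsub>E\<^esub> s \<otimes>\<^bsub>E\<^esub> e = e" and clean: "special_clean E (e \<otimes>\<^bsub>E\<^esub> u)"
    define \<phi> where "\<phi> = e \<otimes>\<^bsub>E\<^esub> u"
    note uE = End.Units_closed[OF u]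
    have \<phi>: "\<phi> \<in> carrier E"
      using idempotents_closed[OF e] uE by (simp add: \<phi>_def)
    obtain w where w: "w \<in> carrier E" "\<And>x. x \<in> carrier M \<Longrightarrow> u (w x) = x"
      by (rule Units_inverse[OF u]) blast
    \<comment> \<open>As \<open>u\<close> is onto, eu has the same image as
      \<open>e\<close>.\<close>
    have "e x \<in> \<phi> ` carrier M" if "x \<in> carrier M" for x
      using that w by (intro image_eqI[of _ _ "w x"]) (simp_all add: \<phi>_def)
    then have im: "\<phi> ` carrier M = e ` carrier M"
      using uE by (auto simp: \<phi>_def)
    have "\<forall>y \<in> e ` carrier M. \<phi> (s y) = y"
      using inv corner_right_inverse_iff[OF e \<phi> s] by (simp add: \<phi>_def)
    then have "split_epi R M (M\<lparr>carrier := e ` carrier M\<rparr>) \<phi>"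
      unfolding split_epi_iff[OF e] using \<phi> im s by blast
    moreover have "\<exists>C. complement R M (e ` carrier M) C \<and> perspective R M (Ker \<phi>) C"
      using special_clean_imp_perspective[OF clean[folded \<phi>_def]] unfolding im .
    ultimately obtain t where "t \<in> carrier E" "\<forall>y \<in> e ` carrier M. \<phi> (t y) = y"
        "bij_betw (\<lambda>y. e (t y)) (e ` carrier M) (e ` carrier M)"
      using R e by blast
    then show "\<exists>t \<in> carrier E. e \<otimes>\<^bsub>E\<^esub> u \<otimes>\<^bsub>E\<^esub> t \<otimes>\<^bsub>E\<^esub> e = e \<and>
         e \<otimes>\<^bsub>E\<^esub> t \<otimes>\<^bsub>E\<^esub> e \<in> Units (corner E e)"
      unfolding \<phi>_def[symmetric]
      using corner_right_inverse_iff[OF e \<phi>] corner_Units_iff[OF e] by blast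
  qed
qed

end

section \<open>Equivalence of the six conditions\<close>

theorem theorem3p5:
  fixes R :: "('a, 'k) ring_scheme"
    and M :: "('a, 'b, 'm) module_scheme"
    and S :: "('b \<Rightarrow> 'b) ring"
  assumes "right_module R M"
    and S: "S = End_ring R M"
  shows "all_equivalent
   [perspectivity_transitive R M,

    \<forall>e \<in> idempotents S. \<forall>f \<in> idempotents S.
      perspective R M (f ` carrier M) (e ` carrier M) \<longrightarrow>
      (\<forall>C D. complement R M (f ` carrier M) C \<longrightarrow> complement R M (e ` carrier M) D \<longrightarrow>
         perspective R M C D),

    \<forall>e \<in> idempotents S. \<forall>f \<in> idempotents S.
      perspective R M (f ` carrier M) (e ` carrier M) \<longrightarrow>
      perspective R M ((\<one>\<^bsub>S\<^esub> \<ominus>\<^bsub>S\<^esub> f) ` carrier M) ((\<one>\<^bsub>S\<^esub> \<ominus>\<^bsub>S\<^esub> e) ` carrier M),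

    \<forall>e \<in> idempotents S. \<forall>\<phi>. split_epi R M (M\<lparr>carrier := e ` carrier M\<rparr>) \<phi> \<longrightarrow>
      (\<exists>C. complement R M (e ` carrier M) C \<and>
           perspective R M (a_kernel M (M\<lparr>carrier := e ` carrier M\<rparr>) \<phi>) C) \<longrightarrow>
      (\<exists>\<psi>. splitting R M (M\<lparr>carrier := e ` carrier M\<rparr>) \<phi> \<psi> \<and>
           complement R M (\<psi> ` (e ` carrier M)) ((\<one>\<^bsub>S\<^esub> \<ominus>\<^bsub>S\<^esub> e) ` carrier M)),

    \<forall>e \<in> idempotents S. \<forall>\<phi>. split_epi R M (M\<lparr>carrier := e ` carrier M\<rparr>) \<phi> \<longrightarrow>
      (\<exists>C. complement R M (e ` carrier M) C \<and>
           perspective R M (a_kernel M (M\<lparr>carrier := e ` carrier M\<rparr>) \<phi>) C) \<longrightarrow>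
      (\<exists>\<psi>. splitting R M (M\<lparr>carrier := e ` carrier M\<rparr>) \<phi> \<psi> \<and>
           compose (e ` carrier M) e \<psi> \<in> module_aut R (M\<lparr>carrier := e ` carrier M\<rparr>)),

    \<forall>e \<in> idempotents S. \<forall>s \<in> carrier S. \<forall>u \<in> Units S.
      e \<otimes>\<^bsub>S\<^esub> u \<otimes>\<^bsub>S\<^esub> s \<otimes>\<^bsub>S\<^esub> e = e \<longrightarrow> special_clean S (e \<otimes>\<^bsub>S\<^esub> u) \<longrightarrow>
      (\<exists>t \<in> carrier S. e \<otimes>\<^bsub>S\<^esub> u \<otimes>\<^bsub>S\<^esub> t \<otimes>\<^bsub>S\<^esub> e = e \<and>
         e \<otimes>\<^bsub>S\<^esub> t \<otimes>\<^bsub>S\<^esub> e \<in> Units (corner S e))]"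
proof -
  interpret right_module R M by fact
  have kernel: "a_kernel M (M\<lparr>carrier := A\<rparr>) \<phi> = Ker \<phi>" for A \<phi>
    by (simp add: a_kernel_def')
  let ?P1 = "perspectivity_transitive R M"
  let ?P2 = "\<forall>e \<in> idempotents E. \<forall>f \<in> idempotents E.
      perspective R M (f ` carrier M) (e ` carrier M) \<longrightarrow>
      (\<forall>C D. complement R M (f ` carrier M) C \<longrightarrow> complement R M (e ` carrier M) D \<longrightarrow>
         perspective R M C D)"
  let ?P3 = "\<forall>e \<in> idempotents E. \<forall>f \<in> idempotents E.
      perspective R M (f ` carrier M) (e ` carrier M) \<longrightarrow>
      perspective R M ((\<one>\<^bsub>E\<^esub> \<ominus>\<^bsub>E\<^esub> f) ` carrier M) ((\<one>\<^bsub>E\<^esub> \<ominus>\<^bsub>E\<^esub> e) ` carrier M)"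
  \<comment> \<open>Conditions (1) to (3) are proved in a cycle; each of (4) to (6) is compared with
    (1) directly.\<close>
  have 12: "?P1 \<Longrightarrow> ?P2"
    using transitive_imp_complements_perspective by blast
  have 23: "?P2 \<Longrightarrow> ?P3"
    using idempotent_complement by blast
  have 31: "?P3 \<Longrightarrow> ?P1"
    by (rule transitive_if_complements_perspective)
  have 14: "?P1 \<longleftrightarrow>
    (\<forall>e \<in> idempotents E. \<forall>\<phi>. split_epi R M (M\<lparr>carrier := e ` carrier M\<rparr>) \<phi> \<longrightarrow>
      (\<exists>C. complement R M (e ` carrier M) C \<and> perspective R M (Ker \<phi>) C) \<longrightarrow>
      (\<exists>\<psi>. splitting R M (M\<lparr>carrier := e ` carrier M\<rparr>) \<phi> \<psi> \<and>
           complement R M (\<psi> ` (e ` carrier M)) ((\<one>\<^bsub>E\<^esub> \<ominus>\<^bsub>E\<^esub> e) ` carrier M)))"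
    unfolding transitive_iff_kernel_perspective
    \<comment> \<open>The congruence rules carry the split epimorphism hypothesis to the conclusion,
      which is the only part that changes.\<close>
    by (intro ball_cong refl all_cong1 imp_cong) (rule ex_splitting_complement_iff[symmetric])
  have 1: "?P1 \<longleftrightarrow>
    (\<forall>e \<in> idempotents E. \<forall>\<phi>. split_epi R M (M\<lparr>carrier := e ` carrier M\<rparr>) \<phi> \<longrightarrow>
      (\<exists>C. complement R M (e ` carrier M) C \<and> perspective R M (Ker \<phi>) C) \<longrightarrow>
      (\<exists>t \<in> carrier E. (\<forall>y \<in> e ` carrier M. \<phi> (t y) = y) \<and>
        bij_betw (\<lambda>y. e (t y)) (e ` carrier M) (e ` carrier M)))"
    unfolding transitive_iff_kernel_perspective
    by (intro ball_cong refl all_cong1 imp_cong) (rule ex_splitting_aut_iff_perspective[symmetric])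
  have 15: "?P1 \<longleftrightarrow>
    (\<forall>e \<in> idempotents E. \<forall>\<phi>. split_epi R M (M\<lparr>carrier := e ` carrier M\<rparr>) \<phi> \<longrightarrow>
      (\<exists>C. complement R M (e ` carrier M) C \<and> perspective R M (Ker \<phi>) C) \<longrightarrow>
      (\<exists>\<psi>. splitting R M (M\<lparr>carrier := e ` carrier M\<rparr>) \<phi> \<psi> \<and>
           compose (e ` carrier M) e \<psi> \<in> module_aut R (M\<lparr>carrier := e ` carrier M\<rparr>)))"
    unfolding 1
    by (intro ball_cong refl all_cong1 imp_cong) (rule ex_splitting_aut_iff[symmetric])
  note 16 = 1[folded special_clean_condition_iff]
  have "?P1 = ?P2" "?P1 = ?P3"
    using 12 23 31 by blast+
  then show ?thesis
    unfolding S kernel all_equivalent_def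
    by (simp only: list.set ball_simps simp_thms 14[symmetric] 15[symmetric] 16[symmetric])
qed

end
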